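(* Let $\mathcal{N}\colon A\to B$ be a quantum channel and let $\sigma_A$ be a quantum state. Define the mutual-information SDPI constant at $\sigma_A$ by $$\eta_{\mathrm{MI}}(\mathcal{N},\sigma_A)=\sup_{C,\ \rho_{CA}:\ \rho_A=\sigma_A,\ I(C:A)_\rho>0}\frac{I(C:B)_{\mathcal{N}(\rho)}}{I(C:A)_\rho},$$ where the supremum ranges over every finite-dimensional quantum system $C$. Then $$\eta_{\mathrm{MI}}(\mathcal{N},\sigma_A)=\eta^p_D(\mathcal{N},\sigma_A).$$
   Context: All systems are finite-dimensional. A channel on $A$ acts as the identity on other systems. $D(\rho\|\sigma)=\operatorname{Tr}[\rho(\log\rho-\log\sigma)]$ if $\operatorname{supp}(\rho)\subseteq\operatorname{supp}(\sigma)$, else $+\infty$; $I(A:B)_\rho=D(\rho_{AB}\|\rho_A\otimes\rho_B)$. The SDPI (strong data-processing inequality) constant with product reference is $$\eta^p_D(\mathcal{N},\sigma_A)=\sup_{R,\ \rho_{RA}}\frac{D(\mathcal{N}(\rho_{RA})\|\rho_R\otimes\mathcal{N}(\sigma_A))}{D(\rho_{RA}\|\rho_R\otimes\sigma_A)},$$ over all finite-dimensional $R$. In every ratio optimization, the supremum is over states for which the denominator is strictly positive and finite, and the constant is $0$ if there are none. *)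

theory Defs
  imports
    "HOL-Library.Extended_Real"
    "Jordan_Normal_Form.Schur_Decomposition"
begin

text \<open>
  A finite-dimensional system is given by its dimension, so that suprema over all auxiliary
  systems are suprema over the natural numbers.  A composite system of dimensions
  \<open>m\<close> and \<open>n\<close> (in this order) has dimension \<open>m * n\<close>, and the product basis vector
  with labels \<open>(i, a)\<close> has index \<open>i * n + a\<close>.
\<close>

definition mat_trace :: "complex mat \<Rightarrow> complex" where
  "mat_trace A = (\<Sum>i<dim_row A. A $$ (i, i))"

definition hermitian_mat :: "complex mat \<Rightarrow> bool" where
  "hermitian_mat A \<longleftrightarrow> mat_adjoint A = A"

definition unitary_mat :: "nat \<Rightarrow> complex mat \<Rightarrow> bool" where
  "unitary_mat n U \<longleftrightarrow>
     U \<in> carrier_mat n n \<and> mat_adjoint U * U = 1\<^sub>m n \<and> U * mat_adjoint U = 1\<^sub>m n"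

definition psd_mat :: "nat \<Rightarrow> complex mat \<Rightarrow> bool" where
  "psd_mat n A \<longleftrightarrow>
     A \<in> carrier_mat n n \<and> hermitian_mat A \<and>
     (\<forall>v \<in> carrier_vec n. 0 \<le> Re ((A *\<^sub>v v) \<bullet>c v))"

definition quantum_state :: "nat \<Rightarrow> complex mat \<Rightarrow> bool" where
  "quantum_state n \<rho> \<longleftrightarrow> psd_mat n \<rho> \<and> mat_trace \<rho> = 1"

definition tensor_mat :: "complex mat \<Rightarrow> complex mat \<Rightarrow> complex mat" (infixl "\<otimes>\<^sub>m" 70) where
  "A \<otimes>\<^sub>m B = mat (dim_row A * dim_row B) (dim_col A * dim_col B)
     (\<lambda>(i, j). A $$ (i div dim_row B, j div dim_col B) * B $$ (i mod dim_row B, j mod dim_col B))"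

text \<open>Partial traces over the first and over the second factor of a system of dimension
  \<open>m * n\<close>.\<close>

definition ptrace_fst :: "nat \<Rightarrow> nat \<Rightarrow> complex mat \<Rightarrow> complex mat" where
  "ptrace_fst m n X = mat n n (\<lambda>(a, b). \<Sum>i<m. X $$ (i * n + a, i * n + b))"

definition ptrace_snd :: "nat \<Rightarrow> nat \<Rightarrow> complex mat \<Rightarrow> complex mat" where
  "ptrace_snd m n X = mat m m (\<lambda>(i, j). \<Sum>a<n. X $$ (i * n + a, j * n + a))"

text \<open>For \<open>X = (\<Sum>i j. E\<^sub>i\<^sub>j \<otimes> X\<^sub>i\<^sub>j)\<close> with matrix units \<open>E\<^sub>i\<^sub>j\<close>, the matrix
  \<open>X\<^sub>i\<^sub>j\<close> is \<open>block_mat n X i j\<close>, and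
  \<open>(id \<otimes> N) X = (\<Sum>i j. E\<^sub>i\<^sub>j \<otimes> N X\<^sub>i\<^sub>j)\<close>.\<close>

definition block_mat :: "nat \<Rightarrow> complex mat \<Rightarrow> nat \<Rightarrow> nat \<Rightarrow> complex mat" where
  "block_mat n X i j = mat n n (\<lambda>(a, b). X $$ (i * n + a, j * n + b))"

definition id_tensor ::
    "nat \<Rightarrow> nat \<Rightarrow> nat \<Rightarrow> (complex mat \<Rightarrow> complex mat) \<Rightarrow> complex mat \<Rightarrow> complex mat" where
  "id_tensor k dA dB N X = mat (k * dB) (k * dB)
     (\<lambda>(p, q). N (block_mat dA X (p div dB) (q div dB)) $$ (p mod dB, q mod dB))"

text \<open>Completely positive trace-preserving linear maps; values outside
  \<open>carrier_mat dA dA\<close> are irrelevant.\<close>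

definition quantum_channel :: "nat \<Rightarrow> nat \<Rightarrow> (complex mat \<Rightarrow> complex mat) \<Rightarrow> bool" where
  "quantum_channel dA dB N \<longleftrightarrow>
     (\<forall>X \<in> carrier_mat dA dA. N X \<in> carrier_mat dB dB) \<and>
     (\<forall>X \<in> carrier_mat dA dA. \<forall>Y \<in> carrier_mat dA dA. N (X + Y) = N X + N Y) \<and>
     (\<forall>c. \<forall>X \<in> carrier_mat dA dA. N (c \<cdot>\<^sub>m X) = c \<cdot>\<^sub>m N X) \<and>
     (\<forall>X \<in> carrier_mat dA dA. mat_trace (N X) = mat_trace X) \<and>
     (\<forall>k X. psd_mat (k * dA) X \<longrightarrow> psd_mat (k * dB) (id_tensor k dA dB N X))"

text \<open>Functional calculus for Hermitian matrices: the result does not depend on the chosen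
  diagonalization, so \<open>THE\<close> is well defined.\<close>

definition hermitian_fun :: "(real \<Rightarrow> real) \<Rightarrow> complex mat \<Rightarrow> complex mat" where
  "hermitian_fun f A = (THE B. \<exists>U d. unitary_mat (dim_row A) U \<and>
     A = U * mat_diag (dim_row A) (\<lambda>i. complex_of_real (d i)) * mat_adjoint U \<and>
     B = U * mat_diag (dim_row A) (\<lambda>i. complex_of_real (f (d i))) * mat_adjoint U)"

text \<open>The logarithm of a positive semidefinite matrix is taken on its support and is zero on the
  kernel; this implements the convention \<open>0 log 0 = 0\<close>.\<close>

definition mat_log :: "complex mat \<Rightarrow> complex mat" where
  "mat_log A = hermitian_fun (\<lambda>x. if x > 0 then ln x else 0) A"

definition mat_supp :: "complex mat \<Rightarrow> complex vec set" where
  "mat_supp A = {v \<in> carrier_vec (dim_row A).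
     \<forall>w \<in> carrier_vec (dim_row A). A *\<^sub>v w = 0\<^sub>v (dim_row A) \<longrightarrow> v \<bullet>c w = 0}"

definition rel_entropy :: "complex mat \<Rightarrow> complex mat \<Rightarrow> ereal" where
  "rel_entropy \<rho> \<sigma> =
     (if mat_supp \<rho> \<subseteq> mat_supp \<sigma>
      then ereal (Re (mat_trace (\<rho> * (mat_log \<rho> - mat_log \<sigma>))))
      else \<infinity>)"

definition mutual_info :: "nat \<Rightarrow> nat \<Rightarrow> complex mat \<Rightarrow> ereal" where
  "mutual_info m n \<rho> = rel_entropy \<rho> (ptrace_snd m n \<rho> \<otimes>\<^sub>m ptrace_fst m n \<rho>)"

definition sup_or_zero :: "ereal set \<Rightarrow> ereal" where
  "sup_or_zero S = (if S = {} then 0 else Sup S)"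

definition eta_D_prod :: "nat \<Rightarrow> nat \<Rightarrow> (complex mat \<Rightarrow> complex mat) \<Rightarrow> complex mat \<Rightarrow> ereal" where
  "eta_D_prod dA dB N \<sigma> = sup_or_zero
     {rel_entropy (id_tensor r dA dB N \<rho>) (ptrace_snd r dA \<rho> \<otimes>\<^sub>m N \<sigma>) /
      rel_entropy \<rho> (ptrace_snd r dA \<rho> \<otimes>\<^sub>m \<sigma>) | r \<rho>.
        quantum_state (r * dA) \<rho> \<and>
        0 < rel_entropy \<rho> (ptrace_snd r dA \<rho> \<otimes>\<^sub>m \<sigma>) \<and>
        rel_entropy \<rho> (ptrace_snd r dA \<rho> \<otimes>\<^sub>m \<sigma>) < \<infinity>}"

definition eta_MI :: "nat \<Rightarrow> nat \<Rightarrow> (complex mat \<Rightarrow> complex mat) \<Rightarrow> complex mat \<Rightarrow> ereal" where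
  "eta_MI dA dB N \<sigma> = sup_or_zero
     {mutual_info c dB (id_tensor c dA dB N \<rho>) / mutual_info c dA \<rho> | c \<rho>.
        quantum_state (c * dA) \<rho> \<and>
        ptrace_fst c dA \<rho> = \<sigma> \<and>
        0 < mutual_info c dA \<rho> \<and> mutual_info c dA \<rho> < \<infinity>}"

end

theory Submission
  imports Defs "Jordan_Normal_Form.Spectral_Radius"
begin

text \<open>
  Every competitor for the mutual-information constant is one for the product-reference constant, so
  only the reverse inequality needs an argument.  If \<open>D(\<rho>\<^sub>R\<^sub>A \<parallel> \<rho>\<^sub>R \<otimes> \<sigma>)\<close> is finite, the kernel of \<open>\<sigma>\<close> lies in
  that of \<open>\<rho>\<^sub>A\<close>, so \<open>\<sigma> = \<lambda> \<rho>\<^sub>A + (1 - \<lambda>) \<tau>\<close> for a state \<open>\<tau>\<close> as soon as \<open>\<lambda>\<close> is small.  Enlarging \<open>R\<close> by one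
  dimension, the block-diagonal state \<open>\<lambda> \<rho>\<^sub>R\<^sub>A \<oplus> (1 - \<lambda>) \<tau>\<close> has marginal \<open>\<sigma>\<close> and mutual information
  \<open>\<lambda> D(\<rho>\<^sub>R\<^sub>A \<parallel> \<rho>\<^sub>R \<otimes> \<sigma>) + (1 - \<lambda>) D(\<tau> \<parallel> \<sigma>)\<close>, and likewise after applying \<open>N\<close>.  The chi-square bound
  gives \<open>D(\<tau> \<parallel> \<sigma>) = O(\<lambda>\<^sup>2)\<close>, while \<open>D(N \<tau> \<parallel> N \<sigma>) \<ge> 0\<close>; letting \<open>\<lambda> \<rightarrow> 0\<close> recovers the ratio for \<open>\<rho>\<^sub>R\<^sub>A\<close>.
\<close>

subsection \<open>Adjoint and trace\<close>

text \<open>In the mixture the wanted entropies carry the factor \<lambda>, so the contribution of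
  \<tau> to the denominator has to be of smaller order than \<lambda>; continuity of the relative
  entropy would not suffice. What helps is that \<tau> - \<sigma> has order \<lambda> and that
  relative entropy vanishes to second order at \<sigma>. The chi-square divergence makes this
  explicit without differentiating a matrix logarithm: it is quadratic in the entries of \<tau> in
  an eigenbasis of \<sigma>. In the numerator a lower bound is wanted, so there the sign of the
  \<tau> term is enough. The added dimension of R acts as a classical flag: the marginal on R, and
  with it the product of the marginals, is block diagonal with the same blocks as the state, so
  entropies add without cross terms. The recurring obstacle is a singular \<sigma>, where logarithms
  and quotients at the eigenvalue 0 take default values. One fact deals with it throughout: under
  kernel inclusion the first state has no weight on those eigenvectors.\<close>

lemma mat_adjoint_dim [simp]:
  "dim_row (mat_adjoint A) = dim_col A" "dim_col (mat_adjoint A) = dim_row A"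
  by (auto simp: mat_adjoint_def)

lemma mat_adjoint_carrier [simp]:
  "A \<in> carrier_mat n m \<Longrightarrow> mat_adjoint A \<in> carrier_mat m n"
  by (intro carrier_matI) simp_all

lemma mat_adjoint_index [simp]:
  fixes A :: "complex mat"
  shows "i < dim_col A \<Longrightarrow> j < dim_row A \<Longrightarrow> mat_adjoint A $$ (i, j) = cnj (A $$ (j, i))"
  by (simp add: mat_adjoint_def mat_of_rows_def)

lemma mat_adjoint_mat_adjoint [simp]:
  fixes A :: "complex mat"
  shows "mat_adjoint (mat_adjoint A) = A"
  by (rule eq_matI) auto

lemma index_mult_mat_sum:
  assumes "A \<in> carrier_mat n m" "B \<in> carrier_mat m k" "i < n" "j < k"
  shows "(A * B) $$ (i, j) = (\<Sum>l<m. A $$ (i, l) * B $$ (l, j))"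
  using assms by (auto simp: scalar_prod_def atLeast0LessThan)

lemma index_mult_mat_vec_sum:
  assumes "A \<in> carrier_mat n m" "v \<in> carrier_vec m" "i < n"
  shows "(A *\<^sub>v v) $ i = (\<Sum>l<m. A $$ (i, l) * v $ l)"
  using assms by (auto simp: scalar_prod_def atLeast0LessThan)

lemma cscalar_prod_sum:
  fixes v w :: "complex vec"
  assumes "w \<in> carrier_vec n"
  shows "v \<bullet>c w = (\<Sum>i<n. v $ i * cnj (w $ i))"
  using assms by (auto simp: scalar_prod_def atLeast0LessThan)

lemma square_mult_carrier [simp]:
  "A \<in> carrier_mat n n \<Longrightarrow> B \<in> carrier_mat n n \<Longrightarrow> A * B \<in> carrier_mat n n"
  by (rule mult_carrier_mat)

lemma mult_one_square [simp]:
  fixes A :: "'a :: semiring_1 mat"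
  assumes "A \<in> carrier_mat n n"
  shows "1\<^sub>m n * A = A" "A * 1\<^sub>m n = A"
  using assms by simp_all

lemma mat_adjoint_mult:
  fixes A B :: "complex mat"
  assumes A: "A \<in> carrier_mat n m" and B: "B \<in> carrier_mat m k"
  shows "mat_adjoint (A * B) = mat_adjoint B * mat_adjoint A"
proof (rule eq_matI)
  fix i j assume "i < dim_row (mat_adjoint B * mat_adjoint A)" "j < dim_col (mat_adjoint B * mat_adjoint A)"
  hence i: "i < k" and j: "j < n" using A B by auto
  have "mat_adjoint (A * B) $$ (i, j) = (\<Sum>l<m. cnj (A $$ (j, l) * B $$ (l, i)))"
    using i j A B by (simp add: index_mult_mat_sum[OF A B] del: index_mult_mat(1))
  also have "\<dots> = (mat_adjoint B * mat_adjoint A) $$ (i, j)"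
    using i j A B
    by (subst index_mult_mat_sum[of _ k m _ n]) (auto intro!: sum.cong)
  finally show "mat_adjoint (A * B) $$ (i, j) = (mat_adjoint B * mat_adjoint A) $$ (i, j)" .
qed (use A B in auto)

lemma cscalar_prod_adjoint:
  fixes A :: "complex mat"
  assumes A: "A \<in> carrier_mat n m" and v: "v \<in> carrier_vec m" and w: "w \<in> carrier_vec n"
  shows "(A *\<^sub>v v) \<bullet>c w = v \<bullet>c (mat_adjoint A *\<^sub>v w)"
proof -
  have "(A *\<^sub>v v) \<bullet>c w = (\<Sum>i<n. \<Sum>j<m. A $$ (i, j) * v $ j * cnj (w $ i))"
    using w by (simp add: cscalar_prod_sum index_mult_mat_vec_sum[OF A v] sum_distrib_right)
  also have "\<dots> = (\<Sum>j<m. \<Sum>i<n. A $$ (i, j) * v $ j * cnj (w $ i))"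
    by (rule sum.swap)
  also have "\<dots> = (\<Sum>j<m. v $ j * cnj ((mat_adjoint A *\<^sub>v w) $ j))"
    using A w by (intro sum.cong refl, subst index_mult_mat_vec_sum[of _ m n])
      (auto simp: sum_distrib_left intro!: sum.cong)
  also have "\<dots> = v \<bullet>c (mat_adjoint A *\<^sub>v w)"
    using A w by (subst cscalar_prod_sum[of _ m]) (auto intro!: mult_mat_vec_carrier)
  finally show ?thesis .
qed

lemma mat_trace_sum:
  "A \<in> carrier_mat n m \<Longrightarrow> mat_trace A = (\<Sum>i<n. A $$ (i, i))"
  by (auto simp: mat_trace_def)

lemma mat_trace_comm:
  assumes A: "A \<in> carrier_mat n m" and B: "B \<in> carrier_mat m n"
  shows "mat_trace (A * B) = mat_trace (B * A)"
proof -
  have "mat_trace (A * B) = (\<Sum>i<n. \<Sum>l<m. A $$ (i, l) * B $$ (l, i))"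
    using A B by (simp add: mat_trace_sum[of _ n n] index_mult_mat_sum[OF A B] del: index_mult_mat(1))
  also have "\<dots> = (\<Sum>l<m. \<Sum>i<n. B $$ (l, i) * A $$ (i, l))"
    by (subst sum.swap) (simp add: mult.commute)
  also have "\<dots> = mat_trace (B * A)"
    using A B by (simp add: mat_trace_sum[of _ m m] index_mult_mat_sum[OF B A] del: index_mult_mat(1))
  finally show ?thesis .
qed

lemma mat_trace_minus:
  "A \<in> carrier_mat n n \<Longrightarrow> B \<in> carrier_mat n n \<Longrightarrow> mat_trace (A - B) = mat_trace A - mat_trace B"
  by (subst (1 2 3) mat_trace_sum[of _ n n]) (auto simp: sum_subtractf minus_carrier_mat)

lemma mat_trace_smult:
  "A \<in> carrier_mat n n \<Longrightarrow> mat_trace (c \<cdot>\<^sub>m A) = c * mat_trace A"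
  by (auto simp: mat_trace_sum[of _ n n] sum_distrib_left)

lemma hermitian_matD:
  "hermitian_mat A \<Longrightarrow> mat_adjoint A = A"
  by (simp add: hermitian_mat_def)

lemma hermitian_mat_iff:
  assumes "A \<in> carrier_mat n n"
  shows "hermitian_mat A \<longleftrightarrow> (\<forall>i<n. \<forall>j<n. A $$ (i, j) = cnj (A $$ (j, i)))" (is "_ \<longleftrightarrow> ?R")
proof
  assume "hermitian_mat A"
  thus ?R using assms mat_adjoint_index[of _ A] unfolding hermitian_mat_def by (metis carrier_matD)
next
  assume R: ?R
  show "hermitian_mat A" unfolding hermitian_mat_def
  proof (rule eq_matI)
    fix i j assume "i < dim_row A" "j < dim_col A"
    thus "mat_adjoint A $$ (i, j) = A $$ (i, j)"
      using R[rule_format, of i j] assms by simp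
  qed (use assms in auto)
qed

lemma psd_matD:
  assumes "psd_mat n A"
  shows "A \<in> carrier_mat n n" "hermitian_mat A"
    "\<And>v. v \<in> carrier_vec n \<Longrightarrow> 0 \<le> Re ((A *\<^sub>v v) \<bullet>c v)"
  using assms by (auto simp: psd_mat_def)

subsection \<open>Unitary matrices\<close>

lemma unitary_matD:
  assumes "unitary_mat n U"
  shows "U \<in> carrier_mat n n" "mat_adjoint U \<in> carrier_mat n n"
    "mat_adjoint U * U = 1\<^sub>m n" "U * mat_adjoint U = 1\<^sub>m n"
  using assms by (auto simp: unitary_mat_def)

lemma mat_adjoint_one [simp]: "mat_adjoint (1\<^sub>m n :: complex mat) = 1\<^sub>m n"
  by (rule eq_matI) auto

lemma unitary_mat_one: "unitary_mat n (1\<^sub>m n)"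
  by (simp add: unitary_mat_def)

lemma unitary_mat_adjoint:
  "unitary_mat n U \<Longrightarrow> unitary_mat n (mat_adjoint U)"
  by (auto simp: unitary_mat_def)

lemma unitary_mat_mult:
  assumes U: "unitary_mat n U" and V: "unitary_mat n V"
  shows "unitary_mat n (U * V)"
proof -
  note u = unitary_matD[OF U] and v = unitary_matD[OF V]
  have adj: "mat_adjoint (U * V) = mat_adjoint V * mat_adjoint U"
    by (rule mat_adjoint_mult) (use u v in auto)
  have "mat_adjoint V * mat_adjoint U * (U * V) = mat_adjoint V * (mat_adjoint U * U) * V"
    using u(1,2) v(1,2) by (simp add: assoc_mult_mat[of _ n n _ n _ n])
  also have "\<dots> = 1\<^sub>m n" using u v by simp
  finally have 1: "mat_adjoint V * mat_adjoint U * (U * V) = 1\<^sub>m n" .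
  have "U * V * (mat_adjoint V * mat_adjoint U) = U * (V * mat_adjoint V) * mat_adjoint U"
    using u(1,2) v(1,2) by (simp add: assoc_mult_mat[of _ n n _ n _ n])
  also have "\<dots> = 1\<^sub>m n" using u v by simp
  finally show ?thesis using 1 u v by (simp add: unitary_mat_def adj)
qed

lemma unitary_mat_of_left_inverse:
  assumes U: "U \<in> carrier_mat n n" and "mat_adjoint U * U = 1\<^sub>m n"
  shows "unitary_mat n U"
  using mat_mult_left_right_inverse[of "mat_adjoint U" n U] assms by (simp add: unitary_mat_def)

lemma unitary_mat_row_sum:
  assumes U: "unitary_mat n U" and i: "i < n"
  shows "(\<Sum>j<n. (cmod (U $$ (i, j)))\<^sup>2) = 1"
proof -
  note u = unitary_matD[OF U]
  have "of_real (\<Sum>j<n. (cmod (U $$ (i, j)))\<^sup>2) = (\<Sum>j<n. U $$ (i, j) * cnj (U $$ (i, j)))"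
    by (simp add: complex_norm_square del: of_real_power)
  also have "\<dots> = (U * mat_adjoint U) $$ (i, i)"
    using u(1) i by (subst index_mult_mat_sum[of _ n n _ n]) auto
  also have "\<dots> = 1" using u i by simp
  finally show ?thesis by (metis of_real_eq_1_iff)
qed

lemma unitary_mat_col_sum:
  assumes U: "unitary_mat n U" and j: "j < n"
  shows "(\<Sum>i<n. (cmod (U $$ (i, j)))\<^sup>2) = 1"
  using unitary_mat_row_sum[OF unitary_mat_adjoint[OF U] j] unitary_matD(1)[OF U] j by simp

subsection \<open>Direct sums\<close>

text \<open>A composite index \<open>i * n + a\<close> lists the blocks of the first factor
  contiguously. Appending an \<open>n\<close>-dimensional block to a matrix on an
  \<open>r * n\<close>-dimensional system therefore gives a matrix on a
  \<open>Suc r * n\<close>-dimensional one; this realises the flag dimension of the reference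
  system.\<close>

definition direct_sum_mat :: "complex mat \<Rightarrow> complex mat \<Rightarrow> complex mat" (infixl "\<oplus>\<^sub>m" 65) where
  "A \<oplus>\<^sub>m B = four_block_mat A (0\<^sub>m (dim_row A) (dim_col B)) (0\<^sub>m (dim_row B) (dim_col A)) B"

lemma direct_sum_carrier [simp]:
  "A \<in> carrier_mat n k \<Longrightarrow> B \<in> carrier_mat m l \<Longrightarrow> A \<oplus>\<^sub>m B \<in> carrier_mat (n + m) (k + l)"
  by (auto simp: direct_sum_mat_def)

lemma direct_sum_dim [simp]:
  "dim_row (A \<oplus>\<^sub>m B) = dim_row A + dim_row B" "dim_col (A \<oplus>\<^sub>m B) = dim_col A + dim_col B"
  by (auto simp: direct_sum_mat_def)

lemma direct_sum_index:
  "i < dim_row A + dim_row B \<Longrightarrow> j < dim_col A + dim_col B \<Longrightarrow> (A \<oplus>\<^sub>m B) $$ (i, j) =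
    (if i < dim_row A then if j < dim_col A then A $$ (i, j) else 0
     else if j < dim_col A then 0 else B $$ (i - dim_row A, j - dim_col A))"
  by (auto simp: direct_sum_mat_def)

lemma direct_sum_mult:
  assumes "A \<in> carrier_mat n n" "B \<in> carrier_mat m m" "C \<in> carrier_mat n n" "D \<in> carrier_mat m m"
  shows "(A \<oplus>\<^sub>m B) * (C \<oplus>\<^sub>m D) = (A * C) \<oplus>\<^sub>m (B * D)"
  unfolding direct_sum_mat_def using assms
  by (subst mult_four_block_mat[of _ n n _ m _ m _ _ n _ m]) auto

lemma direct_sum_mult_vec:
  assumes "A \<in> carrier_mat n n" "B \<in> carrier_mat m m" "v \<in> carrier_vec n" "w \<in> carrier_vec m"
  shows "(A \<oplus>\<^sub>m B) *\<^sub>v (v @\<^sub>v w) = (A *\<^sub>v v) @\<^sub>v (B *\<^sub>v w)"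
  unfolding direct_sum_mat_def using assms
  by (subst four_block_mat_mult_vec[of _ n n _ m _ m]) auto

lemma direct_sum_adjoint:
  "mat_adjoint (A \<oplus>\<^sub>m B) = mat_adjoint A \<oplus>\<^sub>m mat_adjoint B"
  by (rule eq_matI) (auto simp: direct_sum_index)

lemma direct_sum_one: "1\<^sub>m n \<oplus>\<^sub>m 1\<^sub>m m = 1\<^sub>m (n + m)"
  by (rule eq_matI) (auto simp: direct_sum_index)

lemma direct_sum_mat_diag:
  "mat_diag n f \<oplus>\<^sub>m mat_diag m g = mat_diag (n + m) (\<lambda>i. if i < n then f i else g (i - n))"
  by (rule eq_matI) (auto simp: direct_sum_index mat_diag_def)

lemma direct_sum_minus:
  assumes "A \<in> carrier_mat n n" "B \<in> carrier_mat m m" "C \<in> carrier_mat n n" "D \<in> carrier_mat m m"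
  shows "(A \<oplus>\<^sub>m B) - (C \<oplus>\<^sub>m D) = (A - C) \<oplus>\<^sub>m (B - D)"
  using assms by (intro eq_matI) (auto simp: direct_sum_index)

lemma direct_sum_trace:
  assumes "A \<in> carrier_mat n n" "B \<in> carrier_mat m m"
  shows "mat_trace (A \<oplus>\<^sub>m B) = mat_trace A + mat_trace B"
proof -
  have "mat_trace (A \<oplus>\<^sub>m B) = (\<Sum>i<n + m. if i < n then A $$ (i, i) else B $$ (i - n, i - n))"
    unfolding mat_trace_def using assms by (intro sum.cong) (auto simp: direct_sum_index)
  also have "\<dots> = (\<Sum>i<n. A $$ (i, i)) + (\<Sum>i<m. B $$ (i, i))"
    by (induction m) auto
  finally show ?thesis using assms by (auto simp: mat_trace_def)
qed

lemma unitary_mat_direct_sum: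
  assumes "unitary_mat n U" "unitary_mat m V"
  shows "unitary_mat (n + m) (U \<oplus>\<^sub>m V)"
  using unitary_matD[OF assms(1)] unitary_matD[OF assms(2)]
  by (simp add: unitary_mat_def direct_sum_adjoint direct_sum_mult[of _ n _ m] direct_sum_one)

subsection \<open>The spectral theorem\<close>

text \<open>\<open>basis_completion\<close> followed by \<open>gram_schmidt\<close> keeps
  \<open>v\<close> as first vector and yields an orthogonal family that need not have unit length.
  The columns are rescaled by their norms, which is why the first one is only a multiple of
  \<open>v\<close>.\<close>

lemma unitary_with_first_column:
  fixes v :: "complex vec"
  assumes v: "v \<in> carrier_vec n" and v0: "v \<noteq> 0\<^sub>v n"
  obtains W c where "unitary_mat n W" "col W 0 = c \<cdot>\<^sub>v v" "n \<noteq> 0"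
proof -
  interpret cof_vec_space n "TYPE(complex)" .
  define ws where "ws = gram_schmidt n (basis_completion v)"
  note bc = basis_completion[OF v v0]
  have n: "n \<noteq> 0" using v v0 by auto
  have "length (basis_completion v) = n" "hd (basis_completion v) = v" using bc by auto
  then obtain vs where bv: "basis_completion v = v # vs" using n
    by (cases "basis_completion v") auto
  have ws: "set ws \<subseteq> carrier_vec n" "corthogonal ws" "length ws = n"
    using gram_schmidt_result[OF bc(2,4,5), of ws] bc(6) by (auto simp: ws_def)
  have "hd ws = v" using gram_schmidt_hd[OF v, of vs] by (simp add: ws_def bv)
  hence ws0: "ws ! 0 = v" using ws(3) n by (metis hd_conv_nth length_0_conv)
  have wc: "ws ! i \<in> carrier_vec n" if "i < n" for i using ws that by auto
  define nr where "nr i = (\<Sum>l<n. (cmod (ws ! i $ l))\<^sup>2)" for i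
  have nr: "ws ! i \<bullet>c ws ! i = of_real (nr i)" if "i < n" for i
    using wc[OF that] by (simp add: cscalar_prod_sum[of _ n] nr_def complex_norm_square del: of_real_power)
  have nr0: "nr i > 0" if "i < n" for i
  proof -
    have "nr i \<noteq> 0" using corthogonalD[OF ws(2), of i i] nr[OF that] that ws(3) by auto
    moreover have "nr i \<ge> 0" unfolding nr_def by (intro sum_nonneg) auto
    ultimately show ?thesis by simp
  qed
  define W where "W = mat n n (\<lambda>(l, i). ws ! i $ l / of_real (sqrt (nr i)))"
  have W: "W \<in> carrier_mat n n" by (simp add: W_def)
  have "mat_adjoint W * W = 1\<^sub>m n"
  proof (rule eq_matI)
    fix i j assume "i < dim_row (1\<^sub>m n :: complex mat)" "j < dim_col (1\<^sub>m n :: complex mat)"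
    hence i: "i < n" and j: "j < n" by auto
    have "(mat_adjoint W * W) $$ (i, j) = (\<Sum>l<n. cnj (W $$ (l, i)) * W $$ (l, j))"
      using W i j by (subst index_mult_mat_sum[of _ n n _ n]) auto
    also have "\<dots> = (\<Sum>l<n. ws ! j $ l * cnj (ws ! i $ l)) / of_real (sqrt (nr i) * sqrt (nr j))"
      using i j by (simp add: W_def sum_divide_distrib mult.commute)
    also have "(\<Sum>l<n. ws ! j $ l * cnj (ws ! i $ l)) = ws ! j \<bullet>c ws ! i"
      using wc[OF i] by (simp add: cscalar_prod_sum)
    also have "\<dots> / of_real (sqrt (nr i) * sqrt (nr j)) = (if i = j then 1 else 0)"
    proof (cases "i = j")
      case True
      thus ?thesis using nr[OF i] nr0[OF i] by (simp del: of_real_mult)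
    next
      case False
      hence "ws ! j \<bullet>c ws ! i = 0" using corthogonalD[OF ws(2), of j i] i j ws(3) by auto
      thus ?thesis using False by simp
    qed
    also have "\<dots> = 1\<^sub>m n $$ (i, j)" using i j by simp
    finally show "(mat_adjoint W * W) $$ (i, j) = 1\<^sub>m n $$ (i, j)" .
  qed (use W in auto)
  hence "unitary_mat n W" by (rule unitary_mat_of_left_inverse[OF W])
  moreover have "col W 0 = (1 / of_real (sqrt (nr 0))) \<cdot>\<^sub>v v"
    using n v ws0 by (intro eq_vecI) (auto simp: W_def)
  ultimately show ?thesis using n that by blast
qed

text \<open>Isolates the conditions that \<open>hermitian_fun\<close> puts on \<open>U\<close> and
  \<open>d\<close>, so that a diagonalization, once chosen, can be carried through all later
  computations.\<close>

definition diagonalizes :: "nat \<Rightarrow> complex mat \<Rightarrow> (nat \<Rightarrow> real) \<Rightarrow> complex mat \<Rightarrow> bool" where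
  "diagonalizes n U d A \<longleftrightarrow> unitary_mat n U \<and>
     A = U * mat_diag n (\<lambda>i. complex_of_real (d i)) * mat_adjoint U"

lemma diagonalizesD:
  assumes "diagonalizes n U d A"
  shows "unitary_mat n U" "A = U * mat_diag n (\<lambda>i. complex_of_real (d i)) * mat_adjoint U"
    "A \<in> carrier_mat n n"
  using assms unitary_matD[of n U] by (auto simp: diagonalizes_def)

lemma hermitian_mat_conj:
  assumes "A \<in> carrier_mat n n" "hermitian_mat A" "U \<in> carrier_mat n m"
  shows "hermitian_mat (mat_adjoint U * A * U)"
proof -
  have "mat_adjoint (mat_adjoint U * A * U) = mat_adjoint U * mat_adjoint (mat_adjoint U * A)"
    using assms by (subst mat_adjoint_mult[of _ m n _ m]) auto
  also have "mat_adjoint (mat_adjoint U * A) = A * U"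
    using assms by (subst mat_adjoint_mult[of _ m n _ n]) (auto simp: hermitian_matD)
  finally show ?thesis
    using assms by (simp add: hermitian_mat_def assoc_mult_mat[of _ m n _ n _ m])
qed

lemma diagonalizes_direct_sum:
  assumes "diagonalizes n U d A" "diagonalizes m V e B"
  shows "diagonalizes (n + m) (U \<oplus>\<^sub>m V) (\<lambda>i. if i < n then d i else e (i - n)) (A \<oplus>\<^sub>m B)"
proof -
  note a = diagonalizesD[OF assms(1)] and b = diagonalizesD[OF assms(2)]
  note u = unitary_matD(1,2)[OF a(1)] and v = unitary_matD(1,2)[OF b(1)]
  have "A \<oplus>\<^sub>m B = (U \<oplus>\<^sub>m V) * (mat_diag n (\<lambda>i. complex_of_real (d i)) \<oplus>\<^sub>m
      mat_diag m (\<lambda>i. complex_of_real (e i))) * mat_adjoint (U \<oplus>\<^sub>m V)"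
    using u v by (subst a(2), subst b(2)) (simp add: direct_sum_adjoint direct_sum_mult[of _ n _ m])
  thus ?thesis using unitary_mat_direct_sum[OF a(1) b(1)]
    by (simp add: diagonalizes_def direct_sum_mat_diag if_distrib)
qed

lemma diagonalizes_conj:
  assumes W: "unitary_mat n W" and "diagonalizes n U d B" and A: "A \<in> carrier_mat n n"
    and B: "B = mat_adjoint W * A * W"
  shows "diagonalizes n (W * U) d A"
proof -
  note b = diagonalizesD[OF assms(2)]
  note u = unitary_matD(1,2)[OF b(1)] and w = unitary_matD[OF W]
  have "A = (W * mat_adjoint W) * A * (W * mat_adjoint W)" using w A by simp
  also have "\<dots> = W * B * mat_adjoint W"
    unfolding B using w(1,2) A by (simp add: assoc_mult_mat[of _ n n _ n _ n])
  also have "\<dots> = (W * U) * mat_diag n (\<lambda>i. complex_of_real (d i)) * mat_adjoint (W * U)"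
    using w(1,2) u by (subst b(2)) (simp add: mat_adjoint_mult[of _ n n _ n] assoc_mult_mat[of _ n n _ n _ n])
  finally show ?thesis using unitary_mat_mult[OF W b(1)] by (simp add: diagonalizes_def)
qed

text \<open>Deflation, by induction on the size. In a unitary basis that starts with an eigenvector,
  the first column vanishes below the diagonal; Hermitian symmetry clears the first row as well, so
  the matrix is a one-dimensional block plus a smaller Hermitian one.\<close>

theorem hermitian_diagonalizes:
  assumes "A \<in> carrier_mat n n" "hermitian_mat A"
  shows "\<exists>U d. diagonalizes n U d A"
  using assms
proof (induction n arbitrary: A)
  case 0
  hence "diagonalizes 0 (1\<^sub>m 0) (\<lambda>_. 0) A"
    using unitary_mat_one[of 0] unfolding diagonalizes_def by (auto intro!: eq_matI simp: mat_diag_def)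
  thus ?case by blast
next
  case (Suc n)
  let ?N = "Suc n"
  note A = Suc.prems(1)
  obtain e where "eigenvalue A e" using spectrum_non_empty[OF A] by (auto simp: spectrum_def)
  then obtain v where v: "v \<in> carrier_vec ?N" "v \<noteq> 0\<^sub>v ?N" and ev: "A *\<^sub>v v = e \<cdot>\<^sub>v v"
    using A by (auto simp: eigenvalue_def eigenvector_def)
  obtain W c where W: "unitary_mat ?N W" and col: "col W 0 = c \<cdot>\<^sub>v v"
    using unitary_with_first_column[OF v] by blast
  note w = unitary_matD[OF W]
  define B where "B = mat_adjoint W * A * W"
  have B: "B \<in> carrier_mat ?N ?N" using w A by (auto simp: B_def)
  have Bh: "hermitian_mat B" unfolding B_def by (rule hermitian_mat_conj) (use A Suc.prems w in auto)
  note Bsym = Bh[unfolded hermitian_mat_iff[OF B], rule_format]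
  have "A *\<^sub>v col W 0 = e \<cdot>\<^sub>v col W 0"
    unfolding col using A v ev by (simp add: mult_mat_vec smult_smult_assoc mult.commute)
  hence AW: "(A * W) $$ (i, 0) = e * W $$ (i, 0)" if "i < ?N" for i
    using that A w(1) by (metis (no_types, lifting) carrier_matD col_def col_dim dim_col
        index_col index_mult_mat(2,3) index_smult_vec(1) zero_less_Suc col_mult2)
  have B0: "B $$ (i, 0) = (if i = 0 then e else 0)" if i: "i < ?N" for i
  proof -
    have "B $$ (i, 0) = (mat_adjoint W * (A * W)) $$ (i, 0)"
      using w A by (simp add: B_def assoc_mult_mat[of _ ?N ?N _ ?N _ ?N])
    also have "\<dots> = e * (mat_adjoint W * W) $$ (i, 0)"
      unfolding index_mult_mat_sum[OF w(2,1) i zero_less_Suc]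
        index_mult_mat_sum[OF w(2) mult_carrier_mat[OF A w(1)] i zero_less_Suc] sum_distrib_left
      by (intro sum.cong) (auto simp: AW simp del: index_mult_mat(1))
    also have "\<dots> = (if i = 0 then e else 0)" using i w(3) by simp
    finally show ?thesis .
  qed
  have "B $$ (0, 0) = e" using B0 by simp
  \<comment> \<open>Diagonal entries of a Hermitian matrix are real, so the eigenvalue can serve as
    a value of the real sequence \<open>d\<close>.\<close>
  hence "e = cnj e" using Bsym[of 0 0] by (metis zero_less_Suc)
  hence e_real: "e = of_real (Re e)" by (simp add: complex_eq_iff)
  define C where "C = mat n n (\<lambda>(i, j). B $$ (Suc i, Suc j))"
  have C: "C \<in> carrier_mat n n" by (simp add: C_def)
  have "hermitian_mat C"
    unfolding hermitian_mat_iff[OF C]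
  proof (intro allI impI)
    fix i j assume ij: "i < n" "j < n"
    hence "B $$ (Suc i, Suc j) = cnj (B $$ (Suc j, Suc i))" by (intro Bsym) auto
    thus "C $$ (i, j) = cnj (C $$ (j, i))" using ij by (simp add: C_def)
  qed
  then obtain U d where Ud: "diagonalizes n U d C" using Suc.IH[OF C] by blast
  have "mat 1 1 (\<lambda>_. e) = mat_diag 1 (\<lambda>_. complex_of_real (Re e))"
    unfolding mat_diag_def by (rule eq_matI) (simp_all flip: e_real)
  hence "diagonalizes 1 (1\<^sub>m 1) (\<lambda>_. Re e) (mat 1 1 (\<lambda>_. e))"
    using unitary_mat_one[of 1] by (simp add: diagonalizes_def)
  note ds = diagonalizes_direct_sum[OF this Ud]
  have "B = mat 1 1 (\<lambda>_. e) \<oplus>\<^sub>m C"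
  proof (rule eq_matI)
    fix i j assume "i < dim_row (mat 1 1 (\<lambda>_. e) \<oplus>\<^sub>m C)" "j < dim_col (mat 1 1 (\<lambda>_. e) \<oplus>\<^sub>m C)"
    hence ij: "i < ?N" "j < ?N" using C by auto
    have "B $$ (0, j) = (if j = 0 then cnj e else 0)"
      unfolding Bsym[OF zero_less_Suc ij(2)] B0[OF ij(2)] by simp
    hence "B $$ (0, j) = (if j = 0 then e else 0)" using \<open>e = cnj e\<close> by simp
    thus "B $$ (i, j) = (mat 1 1 (\<lambda>_. e) \<oplus>\<^sub>m C) $$ (i, j)"
      using ij B0[of i] by (auto simp: direct_sum_index C_def)
  qed (use B C in auto)
  with ds have "diagonalizes ?N (1\<^sub>m 1 \<oplus>\<^sub>m U) (\<lambda>i. if i < 1 then Re e else d (i - 1)) B"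
    by simp
  from diagonalizes_conj[OF W this A B_def] show ?case by blast
qed

lemma diagonalizes_mult_right:
  assumes "diagonalizes n U d A"
  shows "A * U = U * mat_diag n (\<lambda>i. complex_of_real (d i))"
proof -
  note u = unitary_matD[OF diagonalizesD(1)[OF assms]]
  show ?thesis using u(1,2,3) by (subst diagonalizesD(2)[OF assms]) (simp add: assoc_mult_mat[of _ n n _ n _ n])
qed

lemma diagonalizes_mult_left:
  assumes "diagonalizes n U d A"
  shows "mat_adjoint U * A = mat_diag n (\<lambda>i. complex_of_real (d i)) * mat_adjoint U"
proof -
  note u = unitary_matD[OF diagonalizesD(1)[OF assms]]
  have "mat_adjoint U * A = (mat_adjoint U * U) * mat_diag n (\<lambda>i. complex_of_real (d i)) * mat_adjoint U"
    using u(1,2) by (subst diagonalizesD(2)[OF assms]) (simp add: assoc_mult_mat[of _ n n _ n _ n])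
  thus ?thesis using u by simp
qed

lemma diagonalizes_eigenvector:
  assumes "diagonalizes n U d A" "j < n"
  shows "A *\<^sub>v col U j = complex_of_real (d j) \<cdot>\<^sub>v col U j"
proof (rule eq_vecI)
  note a = diagonalizesD[OF assms(1)] and u = unitary_matD[OF diagonalizesD(1)[OF assms(1)]]
  fix i assume "i < dim_vec (complex_of_real (d j) \<cdot>\<^sub>v col U j)"
  hence i: "i < n" using u by auto
  have "(A *\<^sub>v col U j) $ i = (A * U) $$ (i, j)" using a u i assms(2) by simp
  also have "\<dots> = complex_of_real (d j) * U $$ (i, j)"
    unfolding diagonalizes_mult_right[OF assms(1)] mat_diag_mult_right[OF u(1)] using i assms(2) by simp
  finally show "(A *\<^sub>v col U j) $ i = (complex_of_real (d j) \<cdot>\<^sub>v col U j) $ i"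
    using i u assms(2) by simp
qed (use diagonalizesD(3)[OF assms(1)] unitary_matD(1)[OF diagonalizesD(1)[OF assms(1)]] in auto)

subsection \<open>Positive semidefinite matrices\<close>

lemma cscalar_prod_conj:
  fixes B :: "complex mat"
  assumes B: "B \<in> carrier_mat n n" and U: "U \<in> carrier_mat n m" and v: "v \<in> carrier_vec m"
  shows "((mat_adjoint U * B * U) *\<^sub>v v) \<bullet>c v = (B *\<^sub>v (U *\<^sub>v v)) \<bullet>c (U *\<^sub>v v)"
proof -
  have Uv: "U *\<^sub>v v \<in> carrier_vec n" and BUv: "B *\<^sub>v (U *\<^sub>v v) \<in> carrier_vec n"
    using U B v by (auto intro!: mult_mat_vec_carrier)
  have "(mat_adjoint U * B * U) *\<^sub>v v = mat_adjoint U *\<^sub>v (B *\<^sub>v (U *\<^sub>v v))"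
    using U B v Uv by (subst assoc_mult_mat_vec[of _ m n _ m], auto intro!: mult_carrier_mat,
      subst assoc_mult_mat_vec[of _ m n _ n], auto)
  thus ?thesis using cscalar_prod_adjoint[of "mat_adjoint U" m n, OF _ BUv v] U by simp
qed

lemma psd_mat_conj:
  assumes B: "psd_mat n B" and U: "U \<in> carrier_mat n m"
  shows "psd_mat m (mat_adjoint U * B * U)"
proof -
  note b = psd_matD[OF B]
  show ?thesis unfolding psd_mat_def
  proof (intro conjI ballI)
    show "mat_adjoint U * B * U \<in> carrier_mat m m" using b U by auto
    show "hermitian_mat (mat_adjoint U * B * U)" by (rule hermitian_mat_conj) (use b U in auto)
    fix v :: "complex vec" assume "v \<in> carrier_vec m"
    thus "0 \<le> Re (((mat_adjoint U * B * U) *\<^sub>v v) \<bullet>c v)"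
      using b(3)[of "U *\<^sub>v v"] U by (simp add: cscalar_prod_conj[OF b(1) U])
  qed
qed

lemma cscalar_prod_mat_diag:
  assumes v: "v \<in> carrier_vec n"
  shows "(mat_diag n (\<lambda>i. complex_of_real (d i)) *\<^sub>v v) \<bullet>c v = of_real (\<Sum>i<n. d i * (cmod (v $ i))\<^sup>2)"
    (is "(?D *\<^sub>v v) \<bullet>c v = _")
proof -
  have "(?D *\<^sub>v v) $ i = of_real (d i) * v $ i" if "i < n" for i
  proof -
    have "(?D *\<^sub>v v) $ i = (\<Sum>l<n. if l = i then of_real (d i) * v $ i else 0)"
      unfolding index_mult_mat_vec_sum[OF mat_diag_dim v that] using that
      by (intro sum.cong) (auto simp: mat_diag_def)
    thus ?thesis using that by simp
  qed
  thus ?thesis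
    unfolding cscalar_prod_sum[OF v] of_real_sum
    by (intro sum.cong) (auto simp: complex_norm_square mult.assoc simp del: of_real_power)
qed

lemma psd_mat_diag:
  assumes "\<And>i. i < n \<Longrightarrow> 0 \<le> d i"
  shows "psd_mat n (mat_diag n (\<lambda>i. complex_of_real (d i)))" (is "psd_mat n ?D")
  unfolding psd_mat_def
proof (intro conjI ballI)
  show "?D \<in> carrier_mat n n" by simp
  thus "hermitian_mat ?D" by (auto simp: hermitian_mat_iff[of _ n] mat_diag_def)
  fix v :: "complex vec" assume v: "v \<in> carrier_vec n"
  show "0 \<le> Re ((?D *\<^sub>v v) \<bullet>c v)"
    unfolding cscalar_prod_mat_diag[OF v] using assms by (auto intro!: sum_nonneg)
qed

lemma diagonalizes_psd:
  assumes "diagonalizes n U d A" and "\<And>i. i < n \<Longrightarrow> 0 \<le> d i"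
  shows "psd_mat n A"
proof -
  note u = unitary_matD(2)[OF diagonalizesD(1)[OF assms(1)]]
  show ?thesis using psd_mat_conj[OF psd_mat_diag u, of d] assms(2)
    by (subst diagonalizesD(2)[OF assms(1)]) simp
qed

lemma diagonalizes_eigenvalue_nonneg:
  assumes "diagonalizes n U d A" "psd_mat n A" "j < n"
  shows "0 \<le> d j"
proof -
  note u = unitary_matD[OF diagonalizesD(1)[OF assms(1)]]
  have c: "col U j \<in> carrier_vec n" using u assms(3) by auto
  have "col U j \<bullet>c col U j = of_real (\<Sum>i<n. (cmod (U $$ (i, j)))\<^sup>2)"
    using u(1) assms(3) by (simp add: cscalar_prod_sum[OF c] complex_norm_square del: of_real_power)
  also have "\<dots> = 1" using unitary_mat_col_sum[OF diagonalizesD(1)[OF assms(1)] assms(3)] by simp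
  finally have "(A *\<^sub>v col U j) \<bullet>c col U j = of_real (d j)"
    unfolding diagonalizes_eigenvector[OF assms(1,3)] using c by simp
  thus ?thesis using psd_matD(3)[OF assms(2) c] by simp
qed

lemma diagonalizes_trace:
  assumes "diagonalizes n U d A"
  shows "mat_trace A = of_real (\<Sum>i<n. d i)"
proof -
  let ?D = "mat_diag n (\<lambda>i. complex_of_real (d i))"
  note u = unitary_matD[OF diagonalizesD(1)[OF assms]]
  have "mat_trace A = mat_trace ((U * ?D) * mat_adjoint U)" by (subst diagonalizesD(2)[OF assms]) simp
  also have "\<dots> = mat_trace (mat_adjoint U * (U * ?D))"
    by (rule mat_trace_comm[of _ n n]) (use u in auto)
  also have "mat_adjoint U * (U * ?D) = (mat_adjoint U * U) * ?D"
    using u(1,2) by (simp add: assoc_mult_mat[of _ n n _ n _ n])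
  also have "\<dots> = ?D" unfolding u(3) by (rule mult_one_square) simp
  also have "mat_trace ?D = of_real (\<Sum>i<n. d i)"
    by (simp add: mat_trace_sum[OF mat_diag_dim]) (simp add: mat_diag_def)
  finally show ?thesis .
qed

subsection \<open>Functional calculus\<close>

text \<open>Independence of the chosen diagonalization, as \<open>THE\<close> requires. The change
  of basis \<open>W\<close> intertwines the two diagonal matrices, so \<open>W $$ (i, j)\<close>
  vanishes unless \<open>e i = d j\<close>. On the surviving entries
  \<open>f (e i) = f (d j)\<close>, hence \<open>W\<close> intertwines the images under
  \<open>f\<close> too.\<close>

lemma hermitian_fun_eq:
  assumes "diagonalizes n U d A"
  shows "hermitian_fun f A = U * mat_diag n (\<lambda>i. complex_of_real (f (d i))) * mat_adjoint U"
proof -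
  note a = diagonalizesD[OF assms]
  note u = unitary_matD[OF a(1)]
  have dim: "dim_row A = n" using a by auto
  show ?thesis unfolding hermitian_fun_def dim
  proof (rule the_equality)
    show "\<exists>V e. unitary_mat n V \<and> A = V * mat_diag n (\<lambda>i. complex_of_real (e i)) * mat_adjoint V \<and>
       U * mat_diag n (\<lambda>i. complex_of_real (f (d i))) * mat_adjoint U =
       V * mat_diag n (\<lambda>i. complex_of_real (f (e i))) * mat_adjoint V"
      using a(1,2) by blast
  next
    fix B assume "\<exists>V e. unitary_mat n V \<and> A = V * mat_diag n (\<lambda>i. complex_of_real (e i)) * mat_adjoint V \<and>
       B = V * mat_diag n (\<lambda>i. complex_of_real (f (e i))) * mat_adjoint V"
    then obtain V e where V: "diagonalizes n V e A"
      and B: "B = V * mat_diag n (\<lambda>i. complex_of_real (f (e i))) * mat_adjoint V"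
      by (auto simp: diagonalizes_def)
    note v = unitary_matD[OF diagonalizesD(1)[OF V]]
    define W where "W = mat_adjoint V * U"
    have W: "W \<in> carrier_mat n n" using u v by (simp add: W_def)
    have "mat_diag n (\<lambda>i. complex_of_real (e i)) * W = mat_adjoint V * A * U"
      using v(1,2) u(1) a(3)
      by (simp add: W_def diagonalizes_mult_left[OF V] assoc_mult_mat[of _ n n _ n _ n])
    also have "\<dots> = W * mat_diag n (\<lambda>i. complex_of_real (d i))"
      using v(1,2) u(1) a(3)
      by (simp add: W_def diagonalizes_mult_right[OF assms] assoc_mult_mat[of _ n n _ n _ n])
    finally have comm: "e i * W $$ (i, j) = W $$ (i, j) * d j" if "i < n" "j < n" for i j
      unfolding mat_diag_mult_left[OF W] mat_diag_mult_right[OF W]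
      using that by (auto dest!: arg_cong[of _ _ "\<lambda>M. M $$ (i, j)"])
    have "mat_diag n (\<lambda>i. complex_of_real (f (e i))) * W = W * mat_diag n (\<lambda>i. complex_of_real (f (d i)))"
      unfolding mat_diag_mult_left[OF W] mat_diag_mult_right[OF W]
    proof (rule cong_mat)
      fix i j assume "i < n" "j < n"
      from comm[OF this] have "W $$ (i, j) = 0 \<or> e i = d j" by (auto simp: mult.commute)
      thus "(case (i, j) of (i, j) \<Rightarrow> complex_of_real (f (e i)) * W $$ (i, j)) =
        (case (i, j) of (i, j) \<Rightarrow> W $$ (i, j) * complex_of_real (f (d j)))" by auto
    qed auto
    hence "V * (mat_diag n (\<lambda>i. complex_of_real (f (e i))) * W) * mat_adjoint U =
      V * (W * mat_diag n (\<lambda>i. complex_of_real (f (d i)))) * mat_adjoint U" by simp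
    moreover have "V * (mat_diag n (\<lambda>i. complex_of_real (f (e i))) * W) * mat_adjoint U =
      V * mat_diag n (\<lambda>i. complex_of_real (f (e i))) * mat_adjoint V * (U * mat_adjoint U)"
      using u(1,2) v(1,2) by (simp add: W_def assoc_mult_mat[of _ n n _ n _ n])
    moreover have "V * (W * mat_diag n (\<lambda>i. complex_of_real (f (d i)))) * mat_adjoint U =
      (V * mat_adjoint V) * U * mat_diag n (\<lambda>i. complex_of_real (f (d i))) * mat_adjoint U"
      using u(1,2) v(1,2) by (simp add: W_def assoc_mult_mat[of _ n n _ n _ n])
    ultimately show "B = U * mat_diag n (\<lambda>i. complex_of_real (f (d i))) * mat_adjoint U"
      using u v by (simp add: B)
  qed
qed

lemma hermitian_fun_carrier:
  assumes "A \<in> carrier_mat n n" "hermitian_mat A"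
  shows "hermitian_fun f A \<in> carrier_mat n n"
proof -
  obtain U d where U: "diagonalizes n U d A" using hermitian_diagonalizes[OF assms] by blast
  show ?thesis using unitary_matD(1,2)[OF diagonalizesD(1)[OF U]] by (simp add: hermitian_fun_eq[OF U])
qed

lemma hermitian_fun_direct_sum:
  assumes "A \<in> carrier_mat n n" "hermitian_mat A" "B \<in> carrier_mat m m" "hermitian_mat B"
  shows "hermitian_fun f (A \<oplus>\<^sub>m B) = hermitian_fun f A \<oplus>\<^sub>m hermitian_fun f B"
proof -
  obtain U d where U: "diagonalizes n U d A" using hermitian_diagonalizes[OF assms(1,2)] by blast
  obtain V e where V: "diagonalizes m V e B" using hermitian_diagonalizes[OF assms(3,4)] by blast
  note u = unitary_matD(1,2)[OF diagonalizesD(1)[OF U]] and v = unitary_matD(1,2)[OF diagonalizesD(1)[OF V]]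
  have "hermitian_fun f A \<oplus>\<^sub>m hermitian_fun f B =
    (U \<oplus>\<^sub>m V) * (mat_diag n (\<lambda>i. complex_of_real (f (d i))) \<oplus>\<^sub>m
      mat_diag m (\<lambda>i. complex_of_real (f (e i)))) * mat_adjoint (U \<oplus>\<^sub>m V)"
    using u v unfolding hermitian_fun_eq[OF U] hermitian_fun_eq[OF V]
    by (simp add: direct_sum_adjoint direct_sum_mult[of _ n _ m])
  also have "\<dots> = hermitian_fun f (A \<oplus>\<^sub>m B)"
    unfolding hermitian_fun_eq[OF diagonalizes_direct_sum[OF U V]]
    by (simp add: direct_sum_mat_diag if_distrib)
  finally show ?thesis ..
qed

text \<open>In the two eigenbases this is the trace of a product of diagonal matrices separated by
  the change of basis \<open>W\<close> and its adjoint. Each weight is a squared modulus because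
  every entry of \<open>W\<close> meets its own conjugate.\<close>

lemma mat_trace_mult_hermitian_fun:
  assumes A: "diagonalizes n U a A" and B: "diagonalizes n V b B"
  shows "mat_trace (A * hermitian_fun f B) =
    of_real (\<Sum>i<n. \<Sum>j<n. (cmod ((mat_adjoint U * V) $$ (i, j)))\<^sup>2 * (a i * f (b j)))"
proof -
  let ?D = "mat_diag n (\<lambda>i. complex_of_real (a i))" and ?F = "mat_diag n (\<lambda>i. complex_of_real (f (b i)))"
  note u = unitary_matD[OF diagonalizesD(1)[OF A]] and v = unitary_matD[OF diagonalizesD(1)[OF B]]
  define W where "W = mat_adjoint U * V"
  have W: "W \<in> carrier_mat n n" using u v by (simp add: W_def)
  have Wa: "mat_adjoint W = mat_adjoint V * U"
    using u v by (simp add: W_def mat_adjoint_mult[of _ n n _ n])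
  have "mat_trace (A * hermitian_fun f B) = mat_trace (U * (?D * W * ?F * mat_adjoint V))"
    using u(1,2) v(1,2) unfolding hermitian_fun_eq[OF B]
    by (subst diagonalizesD(2)[OF A]) (simp add: W_def assoc_mult_mat[of _ n n _ n _ n])
  also have "\<dots> = mat_trace ((?D * W * ?F * mat_adjoint V) * U)"
    by (rule mat_trace_comm[of _ n n]) (use u v W in auto)
  also have "(?D * W * ?F * mat_adjoint V) * U = (?D * W) * (?F * mat_adjoint W)"
    using u(1,2) v(1,2) W by (simp add: Wa assoc_mult_mat[of _ n n _ n _ n])
  also have "mat_trace \<dots> = (\<Sum>i<n. \<Sum>j<n. (?D * W) $$ (i, j) * (?F * mat_adjoint W) $$ (j, i))"
    using W by (subst mat_trace_sum[of _ n n], simp)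
      (intro sum.cong refl, subst index_mult_mat_sum[of _ n n _ n], auto)
  also have "\<dots> = of_real (\<Sum>i<n. \<Sum>j<n. (cmod (W $$ (i, j)))\<^sup>2 * (a i * f (b j)))"
    unfolding of_real_sum mat_diag_mult_left[OF W] mat_diag_mult_left[OF mat_adjoint_carrier[OF W]]
    using W by (intro sum.cong refl) (auto simp: complex_norm_square simp del: of_real_power)
  finally show ?thesis by (simp add: W_def)
qed

subsection \<open>Relative entropy\<close>

definition supp_log :: "real \<Rightarrow> real" where
  "supp_log x = (if x > 0 then ln x else 0)"

lemma mat_log_eq: "mat_log A = hermitian_fun supp_log A"
  unfolding mat_log_def supp_log_def ..

text \<open>Supports are orthogonal complements of kernels, so kernel inclusion gives support
  inclusion at once. For the converse, \<open>A *\<^sub>v (A *\<^sub>v w)\<close> lies in the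
  support of \<open>A\<close> since \<open>A\<close> is Hermitian; if \<open>w\<close> is in the
  kernel of \<open>B\<close>, its inner product with \<open>w\<close> is 0, and this product is the
  squared norm of \<open>A *\<^sub>v w\<close>.\<close>

lemma mat_supp_subset_iff:
  assumes A: "A \<in> carrier_mat n n" and B: "B \<in> carrier_mat n n" and h: "hermitian_mat A"
  shows "mat_supp A \<subseteq> mat_supp B \<longleftrightarrow> (\<forall>w \<in> carrier_vec n. B *\<^sub>v w = 0\<^sub>v n \<longrightarrow> A *\<^sub>v w = 0\<^sub>v n)"
    (is "?L \<longleftrightarrow> ?R")
proof
  assume ?R
  thus ?L using A B by (auto simp: mat_supp_def)
next
  assume L: ?L
  show ?R
  proof (intro ballI impI)
    fix w assume w: "w \<in> carrier_vec n" and Bw: "B *\<^sub>v w = 0\<^sub>v n"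
    have Aw: "A *\<^sub>v w \<in> carrier_vec n" using A w by auto
    have "A *\<^sub>v (A *\<^sub>v w) \<in> mat_supp A"
      unfolding mat_supp_def using A Aw hermitian_matD[OF h]
      by (auto simp: cscalar_prod_adjoint[OF A Aw] intro!: mult_mat_vec_carrier)
    hence "A *\<^sub>v (A *\<^sub>v w) \<in> mat_supp B" using L by blast
    hence "(A *\<^sub>v (A *\<^sub>v w)) \<bullet>c w = 0" using B w Bw by (auto simp: mat_supp_def)
    hence "(A *\<^sub>v w) \<bullet>c (A *\<^sub>v w) = 0"
      using cscalar_prod_adjoint[OF A Aw w] hermitian_matD[OF h] by simp
    thus "A *\<^sub>v w = 0\<^sub>v n" using conjugate_square_eq_0_vec[OF Aw] by simp
  qed
qed

text \<open>For a Hermitian second matrix this is the support condition of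
  \<open>rel_entropy\<close>, with the reference matrix as first argument. Kernel membership is an
  equation that can be tested on explicit vectors, such as eigenvectors and product vectors.\<close>

definition kernel_le :: "nat \<Rightarrow> complex mat \<Rightarrow> complex mat \<Rightarrow> bool" where
  "kernel_le n B A \<longleftrightarrow> (\<forall>w \<in> carrier_vec n. B *\<^sub>v w = 0\<^sub>v n \<longrightarrow> A *\<^sub>v w = 0\<^sub>v n)"

lemma rel_entropy_eq:
  assumes "A \<in> carrier_mat n n" "B \<in> carrier_mat n n" "hermitian_mat A"
  shows "rel_entropy A B = (if kernel_le n B A
    then ereal (Re (mat_trace (A * (mat_log A - mat_log B)))) else \<infinity>)"
  using mat_supp_subset_iff[OF assms] by (simp add: rel_entropy_def kernel_le_def)

lemma append_vec_zero_iff: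
  assumes "u \<in> carrier_vec n" "w \<in> carrier_vec m"
  shows "u @\<^sub>v w = 0\<^sub>v (n + m) \<longleftrightarrow> u = 0\<^sub>v n \<and> w = 0\<^sub>v m"
proof -
  have z: "0\<^sub>v (n + m) = 0\<^sub>v n @\<^sub>v 0\<^sub>v m" by (intro eq_vecI) auto
  show ?thesis unfolding z by (rule append_vec_eq[OF assms(1)]) simp
qed

lemma kernel_le_direct_sum:
  assumes "A \<in> carrier_mat n n" "B \<in> carrier_mat n n" "C \<in> carrier_mat m m" "D \<in> carrier_mat m m"
  shows "kernel_le (n + m) (B \<oplus>\<^sub>m D) (A \<oplus>\<^sub>m C) \<longleftrightarrow> kernel_le n B A \<and> kernel_le m D C"
proof -
  have split: "((B \<oplus>\<^sub>m D) *\<^sub>v (u @\<^sub>v w) = 0\<^sub>v (n + m)) = (B *\<^sub>v u = 0\<^sub>v n \<and> D *\<^sub>v w = 0\<^sub>v m)"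
    if "u \<in> carrier_vec n" "w \<in> carrier_vec m" "B \<in> carrier_mat n n" "D \<in> carrier_mat m m" for B D u w
    using that by (simp add: direct_sum_mult_vec[of _ n _ m] append_vec_zero_iff)
  have "kernel_le (n + m) (B \<oplus>\<^sub>m D) (A \<oplus>\<^sub>m C) \<longleftrightarrow> (\<forall>u \<in> carrier_vec n. \<forall>w \<in> carrier_vec m.
    (B \<oplus>\<^sub>m D) *\<^sub>v (u @\<^sub>v w) = 0\<^sub>v (n + m) \<longrightarrow> (A \<oplus>\<^sub>m C) *\<^sub>v (u @\<^sub>v w) = 0\<^sub>v (n + m))"
    unfolding kernel_le_def
    by (metis append_carrier_vec vec_first_carrier vec_first_last_append vec_last_carrier)
  also have "\<dots> \<longleftrightarrow> (\<forall>u \<in> carrier_vec n. \<forall>w \<in> carrier_vec m.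
    B *\<^sub>v u = 0\<^sub>v n \<and> D *\<^sub>v w = 0\<^sub>v m \<longrightarrow> A *\<^sub>v u = 0\<^sub>v n \<and> C *\<^sub>v w = 0\<^sub>v m)"
    using assms by (simp add: split)
  also have "\<dots> \<longleftrightarrow> kernel_le n B A \<and> kernel_le m D C"
  proof -
    \<comment> \<open>Extracts the condition for one block from the joint one: the other half of the
      vector is set to zero.\<close>
    have "M *\<^sub>v 0\<^sub>v k = 0\<^sub>v k" if "M \<in> carrier_mat k k" for M :: "complex mat" and k
      using that by (intro eq_vecI) auto
    thus ?thesis unfolding kernel_le_def using assms zero_carrier_vec by metis
  qed
  finally show ?thesis .
qed

lemma hermitian_mat_direct_sum:
  assumes "hermitian_mat A" "hermitian_mat B"
  shows "hermitian_mat (A \<oplus>\<^sub>m B)"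
  using assms by (simp add: hermitian_mat_def direct_sum_adjoint)

text \<open>The functional calculus acts blockwise, so both logarithms stay block diagonal and the
  trace splits. No summand is ever \<open>-\<infinity>\<close>, so the \<open>ereal\<close> sum is
  infinite exactly when one of the two kernel conditions fails.\<close>

lemma rel_entropy_direct_sum:
  assumes A: "A \<in> carrier_mat n n" "hermitian_mat A" and B: "B \<in> carrier_mat n n" "hermitian_mat B"
    and C: "C \<in> carrier_mat m m" "hermitian_mat C" and D: "D \<in> carrier_mat m m" "hermitian_mat D"
  shows "rel_entropy (A \<oplus>\<^sub>m C) (B \<oplus>\<^sub>m D) = rel_entropy A B + rel_entropy C D"
proof -
  note log = hermitian_fun_carrier[OF A, of supp_log] hermitian_fun_carrier[OF B, of supp_log]
    hermitian_fun_carrier[OF C, of supp_log] hermitian_fun_carrier[OF D, of supp_log]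
  have "(A \<oplus>\<^sub>m C) * (mat_log (A \<oplus>\<^sub>m C) - mat_log (B \<oplus>\<^sub>m D)) =
    (A * (mat_log A - mat_log B)) \<oplus>\<^sub>m (C * (mat_log C - mat_log D))"
    unfolding mat_log_eq hermitian_fun_direct_sum[OF A C] hermitian_fun_direct_sum[OF B D]
    using A C log by (simp add: direct_sum_minus[of _ n _ m] direct_sum_mult[of _ n _ m] minus_carrier_mat)
  moreover have "A * (mat_log A - mat_log B) \<in> carrier_mat n n" "C * (mat_log C - mat_log D) \<in> carrier_mat m m"
    unfolding mat_log_eq using A C log by (auto simp: minus_carrier_mat)
  ultimately have "mat_trace ((A \<oplus>\<^sub>m C) * (mat_log (A \<oplus>\<^sub>m C) - mat_log (B \<oplus>\<^sub>m D))) =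
    mat_trace (A * (mat_log A - mat_log B)) + mat_trace (C * (mat_log C - mat_log D))"
    by (simp add: direct_sum_trace)
  moreover have "rel_entropy (A \<oplus>\<^sub>m C) (B \<oplus>\<^sub>m D) = (if kernel_le n B A \<and> kernel_le m D C
    then ereal (Re (mat_trace ((A \<oplus>\<^sub>m C) * (mat_log (A \<oplus>\<^sub>m C) - mat_log (B \<oplus>\<^sub>m D))))) else \<infinity>)"
    using A B C D by (subst rel_entropy_eq[of _ "n + m"])
      (simp_all add: hermitian_mat_direct_sum kernel_le_direct_sum)
  ultimately show ?thesis
    by (simp add: rel_entropy_eq[OF A(1) B(1) A(2)] rel_entropy_eq[OF C(1) D(1) C(2)])
qed

text \<open>The squared overlaps of two eigenbases form a doubly stochastic matrix; they turn
  relative entropies into classical double sums over the two spectra.\<close>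

definition overlap :: "complex mat \<Rightarrow> complex mat \<Rightarrow> nat \<Rightarrow> nat \<Rightarrow> real" where
  "overlap U V i j = (cmod ((mat_adjoint U * V) $$ (i, j)))\<^sup>2"

lemma overlap_nonneg: "0 \<le> overlap U V i j"
  by (simp add: overlap_def)

lemma overlap_row_sum:
  "unitary_mat n U \<Longrightarrow> unitary_mat n V \<Longrightarrow> i < n \<Longrightarrow> (\<Sum>j<n. overlap U V i j) = 1"
  unfolding overlap_def by (intro unitary_mat_row_sum unitary_mat_mult unitary_mat_adjoint)

lemma overlap_col_sum:
  "unitary_mat n U \<Longrightarrow> unitary_mat n V \<Longrightarrow> j < n \<Longrightarrow> (\<Sum>i<n. overlap U V i j) = 1"
  unfolding overlap_def by (intro unitary_mat_col_sum unitary_mat_mult unitary_mat_adjoint)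

text \<open>The trace of \<open>A * mat_log A\<close> involves the spectrum of \<open>A\<close>
  alone. As the rows of \<open>overlap U V\<close> sum to 1, it can be spread over the same double
  sum as the cross term; inequalities between entropies can then be proved term by term.\<close>

lemma trace_log_diff:
  assumes A: "diagonalizes n U a A" and B: "diagonalizes n V b B"
  shows "Re (mat_trace (A * (mat_log A - mat_log B))) =
    (\<Sum>i<n. \<Sum>j<n. overlap U V i j * (a i * (supp_log (a i) - supp_log (b j))))"
proof -
  note u = unitary_matD[OF diagonalizesD(1)[OF A]] and v = unitary_matD[OF diagonalizesD(1)[OF B]]
  note ac = diagonalizesD(3)[OF A]
  have log: "mat_log A \<in> carrier_mat n n" "mat_log B \<in> carrier_mat n n"
    unfolding mat_log_eq hermitian_fun_eq[OF A] hermitian_fun_eq[OF B] using u v by auto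
  have "overlap U U i j = (if i = j then 1 else 0)" if "i < n" "j < n" for i j
    using that u(3) by (simp add: overlap_def)
  hence ov: "overlap U U i j * (a i * supp_log (a j)) = (if i = j then a i * supp_log (a j) else 0)"
    if "i < n" "j < n" for i j using that by simp
  have "Re (mat_trace (A * mat_log A)) = (\<Sum>i<n. \<Sum>j<n. if i = j then a i * supp_log (a j) else 0)"
    unfolding mat_log_eq mat_trace_mult_hermitian_fun[OF A A] overlap_def[symmetric] Re_complex_of_real
    by (intro sum.cong refl ov) auto
  also have "\<dots> = (\<Sum>i<n. (\<Sum>j<n. overlap U V i j) * (a i * supp_log (a i)))"
    using overlap_row_sum[OF diagonalizesD(1)[OF A] diagonalizesD(1)[OF B]] by simp
  finally have "Re (mat_trace (A * mat_log A)) = (\<Sum>i<n. \<Sum>j<n. overlap U V i j * (a i * supp_log (a i)))"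
    by (simp add: sum_distrib_right)
  moreover have "Re (mat_trace (A * mat_log B)) = (\<Sum>i<n. \<Sum>j<n. overlap U V i j * (a i * supp_log (b j)))"
    unfolding mat_log_eq mat_trace_mult_hermitian_fun[OF A B] overlap_def by simp
  moreover have "mat_trace (A * (mat_log A - mat_log B)) = mat_trace (A * mat_log A) - mat_trace (A * mat_log B)"
    using ac log by (simp add: mult_minus_distrib_mat[of _ n n _ n] mat_trace_minus[of _ n])
  ultimately show ?thesis by (simp add: right_diff_distrib sum_subtractf)
qed

text \<open>Column \<open>j\<close> of \<open>V\<close> is an eigenvector for the eigenvalue 0, so
  it lies in the kernel of \<open>B\<close> and hence in that of \<open>A\<close>.\<close>

lemma kernel_le_eigenbasis:
  assumes B: "diagonalizes n V b B" and A: "A \<in> carrier_mat n n" and k: "kernel_le n B A"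
    and i: "i < n" and j: "j < n" and b: "b j = 0"
  shows "(A * V) $$ (i, j) = 0"
proof -
  note v = unitary_matD[OF diagonalizesD(1)[OF B]]
  have cv: "col V j \<in> carrier_vec n" using v j by auto
  have "B *\<^sub>v col V j = 0\<^sub>v n"
    unfolding diagonalizes_eigenvector[OF B j] b using v(1) j by (intro eq_vecI) auto
  hence "A *\<^sub>v col V j = 0\<^sub>v n" using k cv by (auto simp: kernel_le_def)
  thus ?thesis
    using i j A v by (metis carrier_matD index_mult_mat(1) index_mult_mat_vec index_zero_vec(1))
qed

text \<open>An entry of \<open>mat_adjoint U * A * V\<close> is computed twice: it is 0 because
  \<open>A\<close> kills column \<open>j\<close> of \<open>V\<close>, and it is \<open>a i\<close>
  times the entry of \<open>mat_adjoint U * V\<close>. Thus, under the kernel condition, the default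
  values of \<open>supp_log\<close> and of division at \<open>b j = 0\<close> carry no
  weight.\<close>

lemma overlap_kernel:
  assumes A: "diagonalizes n U a A" and B: "diagonalizes n V b B" and k: "kernel_le n B A"
    and i: "i < n" and j: "j < n" and b: "b j = 0"
  shows "overlap U V i j * a i = 0"
proof -
  note u = unitary_matD[OF diagonalizesD(1)[OF A]] and v = unitary_matD[OF diagonalizesD(1)[OF B]]
  note ac = diagonalizesD(3)[OF A]
  have "(mat_adjoint U * (A * V)) $$ (i, j) = 0"
    unfolding index_mult_mat_sum[OF u(2) square_mult_carrier[OF ac v(1)] i j]
    using kernel_le_eigenbasis[OF B ac k _ j b] by simp
  moreover have "mat_adjoint U * (A * V) = mat_diag n (\<lambda>i. complex_of_real (a i)) * (mat_adjoint U * V)"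
    using u(1,2) v(1,2) ac diagonalizes_mult_left[OF A] by (simp flip: assoc_mult_mat[of _ n n _ n _ n])
  moreover have "\<dots> $$ (i, j) = a i * (mat_adjoint U * V) $$ (i, j)"
    using u v i j by (subst mat_diag_mult_left[of _ n n]) auto
  ultimately show ?thesis by (auto simp: overlap_def)
qed

lemma kernel_le_smult:
  assumes "A \<in> carrier_mat n n" "B \<in> carrier_mat n n" and c: "c \<noteq> 0"
  shows "kernel_le n (c \<cdot>\<^sub>m B) (c \<cdot>\<^sub>m A) \<longleftrightarrow> kernel_le n B A"
proof -
  have "((c \<cdot>\<^sub>m M) *\<^sub>v w = 0\<^sub>v n) = (M *\<^sub>v w = 0\<^sub>v n)" if "M \<in> carrier_mat n n" "w \<in> carrier_vec n" for M w
  proof -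
    have "(c \<cdot>\<^sub>m M) *\<^sub>v w = c \<cdot>\<^sub>v (M *\<^sub>v w)" using that by (intro eq_vecI) auto
    thus ?thesis using that c by (auto simp: vec_eq_iff)
  qed
  thus ?thesis using assms by (simp add: kernel_le_def)
qed

lemma diagonalizes_smult:
  assumes A: "diagonalizes n U a A"
  shows "diagonalizes n U (\<lambda>i. c * a i) (complex_of_real c \<cdot>\<^sub>m A)"
proof -
  note u = unitary_matD[OF diagonalizesD(1)[OF A]]
  have "mat_diag n (\<lambda>i. complex_of_real (c * a i)) = complex_of_real c \<cdot>\<^sub>m mat_diag n (\<lambda>i. complex_of_real (a i))"
    by (intro eq_matI) (auto simp: mat_diag_def)
  moreover have "complex_of_real c \<cdot>\<^sub>m A = U * (complex_of_real c \<cdot>\<^sub>m mat_diag n (\<lambda>i. complex_of_real (a i))) * mat_adjoint U"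
    using u(1,2) by (subst diagonalizesD(2)[OF A])
      (simp add: mult_smult_distrib[of _ n n _ n] mult_smult_assoc_mat[of _ n n _ n])
  ultimately show ?thesis using diagonalizesD(1)[OF A] by (simp add: diagonalizes_def)
qed

lemma psd_diagonalizes:
  assumes "psd_mat n A"
  obtains U a where "diagonalizes n U a A" "\<And>i. i < n \<Longrightarrow> 0 \<le> a i"
  using hermitian_diagonalizes[OF psd_matD(1,2)[OF assms]] diagonalizes_eigenvalue_nonneg[OF _ assms]
  by blast

lemma hermitian_mat_smult:
  assumes A: "A \<in> carrier_mat n n" "hermitian_mat A"
  shows "hermitian_mat (complex_of_real c \<cdot>\<^sub>m A)"
proof -
  have "complex_of_real c \<cdot>\<^sub>m A \<in> carrier_mat n n" using A by simp
  thus ?thesis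
  proof (subst hermitian_mat_iff[of _ n], assumption, intro allI impI)
    fix i j assume ij: "i < n" "j < n"
    hence sym: "A $$ (i, j) = cnj (A $$ (j, i))" using A(2)[unfolded hermitian_mat_iff[OF A(1)]] by blast
    show "(complex_of_real c \<cdot>\<^sub>m A) $$ (i, j) = cnj ((complex_of_real c \<cdot>\<^sub>m A) $$ (j, i))"
      using ij A(1) by (simp flip: sym)
  qed
qed

text \<open>Both logarithms shift by the same \<open>ln c\<close>, which cancels in the difference.
  Since \<open>supp_log\<close> does not shift at 0, this is argued termwise: the shift is used only
  where both eigenvalues are positive, and every other term vanishes by
  \<open>overlap_kernel\<close>.\<close>

lemma rel_entropy_smult:
  assumes A: "psd_mat n A" and B: "psd_mat n B" and c: "c > 0"
  shows "rel_entropy (complex_of_real c \<cdot>\<^sub>m A) (complex_of_real c \<cdot>\<^sub>m B) = ereal c * rel_entropy A B"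
proof -
  obtain U a where U: "diagonalizes n U a A" and a: "\<And>i. i < n \<Longrightarrow> 0 \<le> a i"
    using psd_diagonalizes[OF A] by blast
  obtain V b where V: "diagonalizes n V b B" and b: "\<And>i. i < n \<Longrightarrow> 0 \<le> b i"
    using psd_diagonalizes[OF B] by blast
  note ps = psd_matD[OF A] psd_matD[OF B]
  have h: "hermitian_mat (complex_of_real c \<cdot>\<^sub>m A)"
    by (rule hermitian_mat_smult[OF ps(1,2)])
  show ?thesis
  proof (cases "kernel_le n B A")
    case True
    have "Re (mat_trace (complex_of_real c \<cdot>\<^sub>m A * (mat_log (complex_of_real c \<cdot>\<^sub>m A) - mat_log (complex_of_real c \<cdot>\<^sub>m B)))) =
      c * Re (mat_trace (A * (mat_log A - mat_log B)))"
      unfolding trace_log_diff[OF U V] trace_log_diff[OF diagonalizes_smult[OF U] diagonalizes_smult[OF V]]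
        sum_distrib_left
    proof (intro sum.cong refl)
      fix i j assume "i \<in> {..<n}" "j \<in> {..<n}"
      hence ij: "i < n" "j < n" by auto
      consider "overlap U V i j * a i = 0" | "a i > 0" "b j > 0"
        using overlap_kernel[OF U V True ij] a[OF ij(1)] b[OF ij(2)]
        by (cases "a i = 0"; cases "b j = 0") auto
      thus "overlap U V i j * (c * a i * (supp_log (c * a i) - supp_log (c * b j))) =
        c * (overlap U V i j * (a i * (supp_log (a i) - supp_log (b j))))"
        by cases (use c in \<open>auto simp: supp_log_def ln_mult\<close>)
    qed
    thus ?thesis using True ps h c
      by (subst (1 2) rel_entropy_eq[of _ n]) (auto simp: kernel_le_smult)
  next
    case False
    thus ?thesis using ps h c
      by (subst (1 2) rel_entropy_eq[of _ n]) (auto simp: kernel_le_smult)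
  qed
qed

lemma overlap_sum_left:
  assumes "unitary_mat n U" "unitary_mat n V"
  shows "(\<Sum>i<n. \<Sum>j<n. overlap U V i j * f i) = (\<Sum>i<n. f i)"
  using overlap_row_sum[OF assms] by (simp flip: sum_distrib_right)

lemma overlap_sum_right:
  assumes "unitary_mat n U" "unitary_mat n V"
  shows "(\<Sum>i<n. \<Sum>j<n. overlap U V i j * f j) = (\<Sum>j<n. f j)"
  by (subst sum.swap) (use overlap_col_sum[OF assms] in \<open>simp flip: sum_distrib_right\<close>)

text \<open>Klein's inequality. Equal traces and doubly stochastic overlaps write 0 as the double
  sum of \<open>overlap U V i j * (a i - b j)\<close>, which is compared termwise through
  \<open>ln x \<le> x - 1\<close> at \<open>x = b j / a i\<close>.\<close>

lemma rel_entropy_nonneg: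
  assumes A: "psd_mat n A" and B: "psd_mat n B" and tr: "mat_trace A = mat_trace B"
  shows "0 \<le> rel_entropy A B"
proof (cases "kernel_le n B A")
  case True
  obtain U a where U: "diagonalizes n U a A" and a: "\<And>i. i < n \<Longrightarrow> 0 \<le> a i"
    using psd_diagonalizes[OF A] by blast
  obtain V b where V: "diagonalizes n V b B" and b: "\<And>i. i < n \<Longrightarrow> 0 \<le> b i"
    using psd_diagonalizes[OF B] by blast
  note un = diagonalizesD(1)[OF U] diagonalizesD(1)[OF V]
  have "(\<Sum>i<n. a i) = (\<Sum>j<n. b j)"
    using tr unfolding diagonalizes_trace[OF U] diagonalizes_trace[OF V] of_real_eq_iff .
  hence "0 = (\<Sum>i<n. \<Sum>j<n. overlap U V i j * a i) - (\<Sum>i<n. \<Sum>j<n. overlap U V i j * b j)"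
    by (simp add: overlap_sum_left[OF un] overlap_sum_right[OF un])
  also have "\<dots> = (\<Sum>i<n. \<Sum>j<n. overlap U V i j * (a i - b j))"
    by (simp add: right_diff_distrib sum_subtractf)
  also have "\<dots> \<le> (\<Sum>i<n. \<Sum>j<n. overlap U V i j * (a i * (supp_log (a i) - supp_log (b j))))"
  proof (intro sum_mono)
    fix i j assume "i \<in> {..<n}" "j \<in> {..<n}"
    hence ij: "i < n" "j < n" by auto
    \<comment> \<open>If \<open>b j = 0\<close> and \<open>a i > 0\<close>, the kernel condition
      forces the overlap to vanish. If \<open>a i = 0\<close>, the left side is nonpositive and the
      right side is 0.\<close>
    consider "overlap U V i j = 0" | "a i = 0" | "a i > 0" "b j > 0"
      using overlap_kernel[OF U V True ij] a[OF ij(1)] b[OF ij(2)]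
      by (cases "a i = 0"; cases "b j = 0") auto
    thus "overlap U V i j * (a i - b j) \<le> overlap U V i j * (a i * (supp_log (a i) - supp_log (b j)))"
    proof cases
      case 3
      have "ln (b j / a i) \<le> b j / a i - 1" using 3 by (intro ln_le_minus_one) auto
      hence "a i * (ln (b j) - ln (a i)) \<le> a i * (b j / a i - 1)" using 3 by (simp add: ln_div)
      also have "\<dots> = b j - a i" using 3 by (simp add: field_simps)
      finally have "a i - b j \<le> a i * (supp_log (a i) - supp_log (b j))"
        using 3 by (simp add: supp_log_def algebra_simps)
      thus ?thesis by (rule mult_left_mono[OF _ overlap_nonneg])
    qed (use a b ij overlap_nonneg[of U V i j] in \<open>auto simp: mult_nonneg_nonneg\<close>)
  qed
  finally show ?thesis using psd_matD[OF A] psd_matD[OF B] True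
    by (simp add: rel_entropy_eq[of _ n] trace_log_diff[OF U V])
next
  case False
  thus ?thesis using psd_matD[OF A] psd_matD[OF B] by (simp add: rel_entropy_eq[of _ n])
qed

text \<open>The terms with \<open>b j = 0\<close> vanish because \<open>x / 0 = 0\<close>; this is harmless since the kernel
  condition makes their numerators vanish too.\<close>

lemma rel_entropy_le_chi_square:
  assumes A: "psd_mat n A" "mat_trace A = 1" and V: "diagonalizes n V b B" and b: "\<And>j. j < n \<Longrightarrow> 0 \<le> b j"
    and k: "kernel_le n B A"
  shows "rel_entropy A B \<le>
    ereal ((\<Sum>j<n. \<Sum>k<n. (cmod ((mat_adjoint V * A * V) $$ (j, k)))\<^sup>2 / b j) - 1)"
proof -
  obtain U a where U: "diagonalizes n U a A" and a: "\<And>i. i < n \<Longrightarrow> 0 \<le> a i"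
    using psd_diagonalizes[OF A(1)] by blast
  note un = diagonalizesD(1)[OF U] diagonalizesD(1)[OF V]
  note u = unitary_matD[OF un(1)] and v = unitary_matD[OF un(2)] and ac = psd_matD(1,2)[OF A(1)]
  define W where "W = mat_adjoint U * V"
  have W: "unitary_mat n W" unfolding W_def by (intro unitary_mat_mult unitary_mat_adjoint un)
  note w = unitary_matD[OF W]
  define T where "T = mat_adjoint V * A * V"
  have T: "T \<in> carrier_mat n n" using ac v by (simp add: T_def)
  have Th: "hermitian_mat T" unfolding T_def by (rule hermitian_mat_conj[OF ac v(1)])
  let ?D = "mat_diag n (\<lambda>i. complex_of_real (a i))"
  have Wa: "mat_adjoint W = mat_adjoint V * U"
    using u v by (simp add: W_def mat_adjoint_mult[of _ n n _ n])
  have "T = mat_adjoint W * (?D * W)"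
    using u(1,2) v(1,2) unfolding T_def Wa
    by (subst diagonalizesD(2)[OF U]) (simp add: W_def assoc_mult_mat[of _ n n _ n _ n])
  have "T * T = (mat_adjoint W * ?D) * (W * mat_adjoint W) * (?D * W)"
    unfolding \<open>T = mat_adjoint W * (?D * W)\<close> using w(1,2) by (simp add: assoc_mult_mat[of _ n n _ n _ n])
  also have "\<dots> = mat_adjoint W * ((?D * ?D) * W)"
    unfolding w(4) using w(1,2) by (simp add: assoc_mult_mat[of _ n n _ n _ n] del: mat_diag_diag)
  finally have TT: "T * T = mat_adjoint W * (mat_diag n (\<lambda>i. complex_of_real (a i) * complex_of_real (a i)) * W)"
    by simp
  \<comment> \<open>The sum over the spectrum of \<open>A\<close> is a diagonal entry of
    \<open>T * T\<close>, that is, the squared norm of row \<open>j\<close> of \<open>T\<close>.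
    This eliminates the eigenbasis of \<open>A\<close> and leaves a bound quadratic in the entries
    of \<open>A\<close> in the basis \<open>V\<close>.\<close>
  have sq: "(\<Sum>i<n. overlap U V i j * (a i)\<^sup>2) = (\<Sum>k<n. (cmod (T $$ (j, k)))\<^sup>2)" if j: "j < n" for j
  proof -
    have "complex_of_real (\<Sum>k<n. (cmod (T $$ (j, k)))\<^sup>2) = (\<Sum>k<n. T $$ (j, k) * T $$ (k, j))"
      unfolding of_real_sum
    proof (intro sum.cong refl)
      fix k assume "k \<in> {..<n}"
      hence "T $$ (k, j) = cnj (T $$ (j, k))" using Th[unfolded hermitian_mat_iff[OF T]] j by blast
      thus "complex_of_real ((cmod (T $$ (j, k)))\<^sup>2) = T $$ (j, k) * T $$ (k, j)"
        by (simp add: complex_norm_square del: of_real_power)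
    qed
    also have "\<dots> = (T * T) $$ (j, j)" by (rule index_mult_mat_sum[OF T T j j, symmetric])
    also have "\<dots> = (\<Sum>i<n. cnj (W $$ (i, j)) * (of_real ((a i)\<^sup>2) * W $$ (i, j)))"
      unfolding TT mat_diag_mult_left[OF w(1)] using w(1) j
      by (subst index_mult_mat_sum[of _ n n _ n]) (auto simp: power2_eq_square)
    also have "\<dots> = complex_of_real (\<Sum>i<n. overlap U V i j * (a i)\<^sup>2)"
      unfolding overlap_def W_def[symmetric] of_real_sum of_real_mult
      by (intro sum.cong) (auto simp: complex_norm_square simp del: of_real_power)
    finally show ?thesis unfolding of_real_eq_iff ..
  qed
  have "(\<Sum>i<n. a i) = 1" using A(2) unfolding diagonalizes_trace[OF U] of_real_eq_1_iff .
  have "(\<Sum>i<n. \<Sum>j<n. overlap U V i j * (a i * (supp_log (a i) - supp_log (b j)))) \<le>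
    (\<Sum>i<n. \<Sum>j<n. overlap U V i j * (a i)\<^sup>2 / b j - overlap U V i j * a i)"
  proof (intro sum_mono)
    fix i j assume "i \<in> {..<n}" "j \<in> {..<n}"
    hence ij: "i < n" "j < n" by auto
    consider "overlap U V i j * a i = 0" | "a i > 0" "b j > 0"
      using overlap_kernel[OF U V k ij] a[OF ij(1)] b[OF ij(2)]
      by (cases "a i = 0"; cases "b j = 0") auto
    thus "overlap U V i j * (a i * (supp_log (a i) - supp_log (b j))) \<le>
      overlap U V i j * (a i)\<^sup>2 / b j - overlap U V i j * a i"
    proof cases
      case 2
      \<comment> \<open>The ratio is the inverse of the one used for nonnegativity, so the same
        inequality now bounds the entropy from above.\<close>
      have "ln (a i / b j) \<le> a i / b j - 1" using 2 by (intro ln_le_minus_one) auto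
      hence "supp_log (a i) - supp_log (b j) \<le> a i / b j - 1" using 2 by (simp add: supp_log_def ln_div)
      hence "overlap U V i j * (a i * (supp_log (a i) - supp_log (b j))) \<le> overlap U V i j * (a i * (a i / b j - 1))"
        using 2 by (intro mult_left_mono overlap_nonneg) auto
      also have "\<dots> = overlap U V i j * (a i)\<^sup>2 / b j - overlap U V i j * a i"
        by (simp add: algebra_simps power2_eq_square)
      finally show ?thesis .
    qed (auto simp: power2_eq_square)
  qed
  also have "\<dots> = (\<Sum>j<n. (\<Sum>i<n. overlap U V i j * (a i)\<^sup>2) / b j) - 1"
    unfolding sum_subtractf overlap_sum_left[OF un] \<open>(\<Sum>i<n. a i) = 1\<close>
    by (subst sum.swap) (simp add: sum_divide_distrib)
  also have "\<dots> = (\<Sum>j<n. \<Sum>k<n. (cmod (T $$ (j, k)))\<^sup>2 / b j) - 1"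
    by (simp add: sq sum_divide_distrib)
  finally show ?thesis
    using ac diagonalizesD(3)[OF V] k
    by (simp add: rel_entropy_eq[of _ n] trace_log_diff[OF U V] T_def)
qed

lemma psd_mat_direct_sum:
  assumes "psd_mat n A" "psd_mat m B"
  shows "psd_mat (n + m) (A \<oplus>\<^sub>m B)"
proof -
  obtain U a where U: "diagonalizes n U a A" and a: "\<And>i. i < n \<Longrightarrow> 0 \<le> a i"
    using psd_diagonalizes[OF assms(1)] by blast
  obtain V b where V: "diagonalizes m V b B" and b: "\<And>i. i < m \<Longrightarrow> 0 \<le> b i"
    using psd_diagonalizes[OF assms(2)] by blast
  show ?thesis by (rule diagonalizes_psd[OF diagonalizes_direct_sum[OF U V]]) (use a b in auto)
qed

lemma psd_mat_smult:
  assumes "psd_mat n A" "0 \<le> c"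
  shows "psd_mat n (complex_of_real c \<cdot>\<^sub>m A)"
proof -
  obtain U a where U: "diagonalizes n U a A" and a: "\<And>i. i < n \<Longrightarrow> 0 \<le> a i"
    using psd_diagonalizes[OF assms(1)] by blast
  show ?thesis by (rule diagonalizes_psd[OF diagonalizes_smult[OF U]]) (use a assms(2) in auto)
qed

subsection \<open>Tensor products\<close>

lemma div_mod_less:
  fixes p m n :: nat
  assumes "p < n * m"
  shows "p div m < n" "p mod m < m" "0 < m"
proof -
  show "0 < m" using assms by (cases m) auto
  thus "p mod m < m" by simp
  show "p div m < n" using assms by (rule less_mult_imp_div_less)
qed

lemma mult_add_less:
  fixes i a m n :: nat
  assumes "i < m" "a < n"
  shows "i * n + a < m * n"
proof -
  have "i * n + a < Suc i * n" using assms(2) by simp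
  also have "\<dots> \<le> m * n" using assms(1) by (intro mult_le_mono1) simp
  finally show ?thesis .
qed

lemma sum_product_index:
  fixes f :: "nat \<Rightarrow> 'a :: comm_monoid_add"
  shows "(\<Sum>p<m * n. f p) = (\<Sum>i<m. \<Sum>a<n. f (i * n + a))"
proof -
  have "sum f {i * n..<i * n + n} = (\<Sum>a<n. f (i * n + a))" for i
    using sum.shift_bounds_nat_ivl[of f 0 "i * n" n] by (simp add: atLeast0LessThan add.commute)
  thus ?thesis by (simp flip: sum.nat_group)
qed

lemma tensor_dim [simp]:
  "dim_row (A \<otimes>\<^sub>m B) = dim_row A * dim_row B" "dim_col (A \<otimes>\<^sub>m B) = dim_col A * dim_col B"
  by (simp_all add: tensor_mat_def)

lemma tensor_carrier [simp]:
  "A \<in> carrier_mat n m \<Longrightarrow> B \<in> carrier_mat k l \<Longrightarrow> A \<otimes>\<^sub>m B \<in> carrier_mat (n * k) (m * l)"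
  by (intro carrier_matI) simp_all

lemma tensor_index:
  "p < dim_row A * dim_row B \<Longrightarrow> q < dim_col A * dim_col B \<Longrightarrow> (A \<otimes>\<^sub>m B) $$ (p, q) =
    A $$ (p div dim_row B, q div dim_col B) * B $$ (p mod dim_row B, q mod dim_col B)"
  by (simp add: tensor_mat_def)

lemma tensor_mult:
  assumes A: "A \<in> carrier_mat n n" and B: "B \<in> carrier_mat m m"
    and C: "C \<in> carrier_mat n n" and D: "D \<in> carrier_mat m m"
  shows "(A \<otimes>\<^sub>m B) * (C \<otimes>\<^sub>m D) = (A * C) \<otimes>\<^sub>m (B * D)"
proof (rule eq_matI)
  fix p q assume "p < dim_row ((A * C) \<otimes>\<^sub>m (B * D))" "q < dim_col ((A * C) \<otimes>\<^sub>m (B * D))"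
  hence p: "p < n * m" and q: "q < n * m" using A B C D by auto
  note p' = div_mod_less[OF p] and q' = div_mod_less[OF q]
  have "((A \<otimes>\<^sub>m B) * (C \<otimes>\<^sub>m D)) $$ (p, q) =
    (\<Sum>i<n. \<Sum>a<m. (A \<otimes>\<^sub>m B) $$ (p, i * m + a) * (C \<otimes>\<^sub>m D) $$ (i * m + a, q))"
    using A B C D p q by (subst index_mult_mat_sum[of _ "n * m" "n * m" _ "n * m"]) (simp_all add: sum_product_index)
  also have "\<dots> = (\<Sum>i<n. \<Sum>a<m. (A $$ (p div m, i) * B $$ (p mod m, a)) * (C $$ (i, q div m) * D $$ (a, q mod m)))"
    using A B C D p q by (intro sum.cong refl) (simp add: tensor_index mult_add_less)
  also have "\<dots> = (\<Sum>i<n. \<Sum>a<m. (A $$ (p div m, i) * C $$ (i, q div m)) * (B $$ (p mod m, a) * D $$ (a, q mod m)))"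
    by (simp add: mult_ac)
  also have "\<dots> = (A * C) $$ (p div m, q div m) * (B * D) $$ (p mod m, q mod m)"
    using p' q' by (simp add: index_mult_mat_sum[OF A C] index_mult_mat_sum[OF B D] sum_product del: index_mult_mat(1))
  also have "\<dots> = ((A * C) \<otimes>\<^sub>m (B * D)) $$ (p, q)"
    using A B C D p q by (simp add: tensor_index)
  finally show "((A \<otimes>\<^sub>m B) * (C \<otimes>\<^sub>m D)) $$ (p, q) = ((A * C) \<otimes>\<^sub>m (B * D)) $$ (p, q)" .
qed (use A B C D in auto)

lemma tensor_adjoint:
  "mat_adjoint (A \<otimes>\<^sub>m B) = mat_adjoint A \<otimes>\<^sub>m mat_adjoint B"
proof (rule eq_matI)
  fix p q assume "p < dim_row (mat_adjoint A \<otimes>\<^sub>m mat_adjoint B)" "q < dim_col (mat_adjoint A \<otimes>\<^sub>m mat_adjoint B)"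
  hence pq: "p < dim_col A * dim_col B" "q < dim_row A * dim_row B" by auto
  thus "mat_adjoint (A \<otimes>\<^sub>m B) $$ (p, q) = (mat_adjoint A \<otimes>\<^sub>m mat_adjoint B) $$ (p, q)"
    using div_mod_less[OF pq(1)] div_mod_less[OF pq(2)] by (simp add: tensor_index)
qed auto

lemma tensor_mat_diag:
  "mat_diag n f \<otimes>\<^sub>m mat_diag m g = mat_diag (n * m) (\<lambda>p. f (p div m) * g (p mod m))"
proof (rule eq_matI)
  fix p q assume "p < dim_row (mat_diag (n * m) (\<lambda>p. f (p div m) * g (p mod m)))"
    "q < dim_col (mat_diag (n * m) (\<lambda>p. f (p div m) * g (p mod m)))"
  hence pq: "p < n * m" "q < n * m" by (auto simp: mat_diag_def)
  have "p = q \<longleftrightarrow> p div m = q div m \<and> p mod m = q mod m" by (metis div_mult_mod_eq)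
  thus "(mat_diag n f \<otimes>\<^sub>m mat_diag m g) $$ (p, q) = mat_diag (n * m) (\<lambda>p. f (p div m) * g (p mod m)) $$ (p, q)"
    using pq div_mod_less[OF pq(1)] div_mod_less[OF pq(2)] by (auto simp: tensor_index mat_diag_def)
qed (auto simp: mat_diag_def)

lemma unitary_mat_tensor:
  assumes "unitary_mat n U" "unitary_mat m V"
  shows "unitary_mat (n * m) (U \<otimes>\<^sub>m V)"
proof -
  note u = unitary_matD[OF assms(1)] and v = unitary_matD[OF assms(2)]
  have "1\<^sub>m n \<otimes>\<^sub>m 1\<^sub>m m = 1\<^sub>m (n * m)"
    using tensor_mat_diag[of n "\<lambda>_. 1" m "\<lambda>_. 1"] by simp
  thus ?thesis using u v by (simp add: unitary_mat_def tensor_adjoint tensor_mult[of _ n _ m])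
qed

lemma psd_mat_tensor:
  assumes "psd_mat n A" "psd_mat m B"
  shows "psd_mat (n * m) (A \<otimes>\<^sub>m B)"
proof -
  obtain U a where U: "diagonalizes n U a A" and a: "\<And>i. i < n \<Longrightarrow> 0 \<le> a i"
    using psd_diagonalizes[OF assms(1)] by blast
  obtain V b where V: "diagonalizes m V b B" and b: "\<And>i. i < m \<Longrightarrow> 0 \<le> b i"
    using psd_diagonalizes[OF assms(2)] by blast
  note u = unitary_matD[OF diagonalizesD(1)[OF U]] and v = unitary_matD[OF diagonalizesD(1)[OF V]]
  have "A \<otimes>\<^sub>m B = (U \<otimes>\<^sub>m V) * (mat_diag n (\<lambda>i. complex_of_real (a i)) \<otimes>\<^sub>m mat_diag m (\<lambda>i. complex_of_real (b i)))
    * mat_adjoint (U \<otimes>\<^sub>m V)"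
    using u(1,2) v(1,2) by (subst diagonalizesD(2)[OF U], subst diagonalizesD(2)[OF V])
      (simp add: tensor_adjoint tensor_mult[of _ n _ m])
  hence "diagonalizes (n * m) (U \<otimes>\<^sub>m V) (\<lambda>p. a (p div m) * b (p mod m)) (A \<otimes>\<^sub>m B)"
    using unitary_mat_tensor[OF diagonalizesD(1)[OF U] diagonalizesD(1)[OF V]]
    by (simp add: diagonalizes_def tensor_mat_diag)
  thus ?thesis by (rule diagonalizes_psd) (use a b div_mod_less in auto)
qed

lemma tensor_smult_left:
  "(c \<cdot>\<^sub>m A) \<otimes>\<^sub>m B = c \<cdot>\<^sub>m (A \<otimes>\<^sub>m B)"
proof (rule eq_matI)
  fix p q assume "p < dim_row (c \<cdot>\<^sub>m (A \<otimes>\<^sub>m B))" "q < dim_col (c \<cdot>\<^sub>m (A \<otimes>\<^sub>m B))"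
  hence pq: "p < dim_row A * dim_row B" "q < dim_col A * dim_col B" by auto
  thus "((c \<cdot>\<^sub>m A) \<otimes>\<^sub>m B) $$ (p, q) = (c \<cdot>\<^sub>m (A \<otimes>\<^sub>m B)) $$ (p, q)"
    using div_mod_less[OF pq(1)] div_mod_less[OF pq(2)] by (simp add: tensor_index)
qed auto

text \<open>Indices from \<open>n * m\<close> on are exactly those with first label
  \<open>n\<close>, where the left factor contributes the scalar \<open>c\<close>. Hence the product
  of the marginals of a flagged state is block diagonal.\<close>

lemma tensor_direct_sum_left:
  assumes A: "A \<in> carrier_mat n n" and B: "B \<in> carrier_mat m m"
  shows "(A \<oplus>\<^sub>m mat 1 1 (\<lambda>_. c)) \<otimes>\<^sub>m B = (A \<otimes>\<^sub>m B) \<oplus>\<^sub>m (c \<cdot>\<^sub>m B)"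
proof (rule eq_matI)
  fix p q assume "p < dim_row ((A \<otimes>\<^sub>m B) \<oplus>\<^sub>m (c \<cdot>\<^sub>m B))" "q < dim_col ((A \<otimes>\<^sub>m B) \<oplus>\<^sub>m (c \<cdot>\<^sub>m B))"
  hence pq: "p < Suc n * m" "q < Suc n * m" using A B by auto
  have low: "k div m < n \<longleftrightarrow> k < n * m" if "k < Suc n * m" for k
    using div_mod_less(3)[OF that] by (simp add: div_less_iff_less_mult)
  have high: "k div m = n" "k mod m = k - n * m" if "k < Suc n * m" "\<not> k < n * m" for k
  proof -
    show "k div m = n" using low[OF that(1)] that div_mod_less(1)[OF that(1)] by simp
    thus "k mod m = k - n * m" by (simp add: modulo_nat_def mult.commute)
  qed
  show "((A \<oplus>\<^sub>m mat 1 1 (\<lambda>_. c)) \<otimes>\<^sub>m B) $$ (p, q) = ((A \<otimes>\<^sub>m B) \<oplus>\<^sub>m (c \<cdot>\<^sub>m B)) $$ (p, q)"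
    using pq A B div_mod_less[OF pq(1)] div_mod_less[OF pq(2)] low[OF pq(1)] low[OF pq(2)]
      high[OF pq(1)] high[OF pq(2)]
    by (auto simp: tensor_index direct_sum_index)
qed (use A B in auto)

subsection \<open>Partial traces\<close>

lemma ptrace_carrier [simp]:
  "ptrace_fst m n X \<in> carrier_mat n n" "ptrace_snd m n X \<in> carrier_mat m m"
  by (simp_all add: ptrace_fst_def ptrace_snd_def)

lemma ptrace_smult:
  assumes "X \<in> carrier_mat (m * n) (m * n)"
  shows "ptrace_fst m n (c \<cdot>\<^sub>m X) = c \<cdot>\<^sub>m ptrace_fst m n X"
    "ptrace_snd m n (c \<cdot>\<^sub>m X) = c \<cdot>\<^sub>m ptrace_snd m n X"
  using assms by (auto intro!: eq_matI simp: ptrace_fst_def ptrace_snd_def mult_add_less sum_distrib_left)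

text \<open>Translates positions in a direct sum into labels of the first factor: label
  \<open>r\<close>, the last of \<open>Suc r\<close>, addresses the appended block. Partial traces
  and channels are defined by these labels, so their action on direct sums is read off from
  here.\<close>

lemma direct_sum_block_index:
  assumes X: "X \<in> carrier_mat (r * n) (r * n)" and Y: "Y \<in> carrier_mat n n"
    and "i \<le> r" "j \<le> r" "a < n" "b < n"
  shows "(X \<oplus>\<^sub>m Y) $$ (i * n + a, j * n + b) =
    (if i < r \<and> j < r then X $$ (i * n + a, j * n + b) else if i = r \<and> j = r then Y $$ (a, b) else 0)"
proof -
  have low: "k * n + a < r * n \<longleftrightarrow> k < r" if "k \<le> r" "a < n" for k a
    using mult_add_less[of k r a n] that by (cases "k = r") auto
  have "k * n + a < r * n + n" if "k \<le> r" "a < n" for k a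
    using mult_add_less[of k "Suc r" a n] that by (simp add: add.commute)
  thus ?thesis using assms low by (subst direct_sum_index) auto
qed

lemma ptrace_fst_direct_sum:
  assumes X: "X \<in> carrier_mat (r * n) (r * n)" and Y: "Y \<in> carrier_mat n n"
  shows "ptrace_fst (Suc r) n (X \<oplus>\<^sub>m Y) = ptrace_fst r n X + Y"
  using Y by (intro eq_matI) (auto simp: ptrace_fst_def direct_sum_block_index[OF X Y])

lemma ptrace_snd_direct_sum:
  assumes X: "X \<in> carrier_mat (r * n) (r * n)" and Y: "Y \<in> carrier_mat n n"
  shows "ptrace_snd (Suc r) n (X \<oplus>\<^sub>m Y) = ptrace_snd r n X \<oplus>\<^sub>m mat 1 1 (\<lambda>_. mat_trace Y)"
proof (rule eq_matI)
  fix i j assume "i < dim_row (ptrace_snd r n X \<oplus>\<^sub>m mat 1 1 (\<lambda>_. mat_trace Y))"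
    "j < dim_col (ptrace_snd r n X \<oplus>\<^sub>m mat 1 1 (\<lambda>_. mat_trace Y))"
  hence ij: "i \<le> r" "j \<le> r" by (auto simp: ptrace_snd_def)
  thus "ptrace_snd (Suc r) n (X \<oplus>\<^sub>m Y) $$ (i, j) = (ptrace_snd r n X \<oplus>\<^sub>m mat 1 1 (\<lambda>_. mat_trace Y)) $$ (i, j)"
    using Y by (auto simp: ptrace_snd_def direct_sum_block_index[OF X Y ij] direct_sum_index mat_trace_sum[OF Y])
qed (auto simp: ptrace_snd_def)

lemma mat_trace_ptrace_fst:
  assumes "X \<in> carrier_mat (m * n) (m * n)"
  shows "mat_trace (ptrace_fst m n X) = mat_trace X"
  unfolding mat_trace_sum[OF assms] mat_trace_sum[OF ptrace_carrier(1)] sum_product_index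
  by (subst sum.swap) (simp add: ptrace_fst_def)

lemma hermitian_ptrace_fst:
  assumes X: "X \<in> carrier_mat (m * n) (m * n)" and h: "hermitian_mat X"
  shows "hermitian_mat (ptrace_fst m n X)"
  unfolding hermitian_mat_iff[OF ptrace_carrier(1)]
proof (intro allI impI)
  fix a b assume ab: "a < n" "b < n"
  have "X $$ (i * n + a, i * n + b) = cnj (X $$ (i * n + b, i * n + a))" if "i < m" for i
    using h[unfolded hermitian_mat_iff[OF X]] mult_add_less[OF that ab(1)] mult_add_less[OF that ab(2)] by blast
  hence "(\<Sum>i<m. X $$ (i * n + a, i * n + b)) = (\<Sum>i<m. cnj (X $$ (i * n + b, i * n + a)))"
    by (intro sum.cong) auto
  thus "ptrace_fst m n X $$ (a, b) = cnj (ptrace_fst m n X $$ (b, a))"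
    using ab by (simp add: ptrace_fst_def)
qed

lemma hermitian_ptrace_snd:
  assumes X: "X \<in> carrier_mat (m * n) (m * n)" and h: "hermitian_mat X"
  shows "hermitian_mat (ptrace_snd m n X)"
  unfolding hermitian_mat_iff[OF ptrace_carrier(2)]
proof (intro allI impI)
  fix i j assume ij: "i < m" "j < m"
  have "X $$ (i * n + a, j * n + a) = cnj (X $$ (j * n + a, i * n + a))" if "a < n" for a
    using h[unfolded hermitian_mat_iff[OF X]] mult_add_less[OF ij(1) that] mult_add_less[OF ij(2) that] by blast
  hence "(\<Sum>a<n. X $$ (i * n + a, j * n + a)) = (\<Sum>a<n. cnj (X $$ (j * n + a, i * n + a)))"
    by (intro sum.cong) auto
  thus "ptrace_snd m n X $$ (i, j) = cnj (ptrace_snd m n X $$ (j, i))"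
    using ij by (simp add: ptrace_snd_def)
qed

text \<open>The quadratic form at \<open>v\<close> is a sum of values of the form of
  \<open>X\<close> at product vectors: \<open>u a\<close> is \<open>v\<close> tensored with the
  \<open>a\<close>-th basis vector.\<close>

lemma psd_ptrace_snd:
  assumes X: "psd_mat (m * n) X"
  shows "psd_mat m (ptrace_snd m n X)"
  unfolding psd_mat_def
proof (intro conjI ballI)
  note x = psd_matD[OF X]
  show "ptrace_snd m n X \<in> carrier_mat m m" by simp
  show "hermitian_mat (ptrace_snd m n X)" by (rule hermitian_ptrace_snd[OF x(1,2)])
  fix v :: "complex vec" assume v: "v \<in> carrier_vec m"
  define u where "u a = vec (m * n) (\<lambda>p. if p mod n = a then v $ (p div n) else 0)" for a
  have u: "u a \<in> carrier_vec (m * n)" for a by (simp add: u_def)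
  have ui: "u a $ (i * n + b) = (if b = a then v $ i else 0)" if "i < m" "b < n" for a i b
    using that by (simp add: u_def mult_add_less)
  have "(X *\<^sub>v u a) \<bullet>c u a = (\<Sum>i<m. \<Sum>j<m. X $$ (i * n + a, j * n + a) * v $ j * cnj (v $ i))" if a: "a < n" for a
  proof -
    have "(X *\<^sub>v u a) \<bullet>c u a = (\<Sum>i<m. \<Sum>b<n. (X *\<^sub>v u a) $ (i * n + b) * cnj (u a $ (i * n + b)))"
      unfolding cscalar_prod_sum[OF u] sum_product_index ..
    also have "\<dots> = (\<Sum>i<m. \<Sum>b<n. if b = a then (X *\<^sub>v u a) $ (i * n + a) * cnj (v $ i) else 0)"
      by (intro sum.cong refl) (simp add: ui)
    also have "\<dots> = (\<Sum>i<m. (X *\<^sub>v u a) $ (i * n + a) * cnj (v $ i))" using a by simp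
    also have "\<dots> = (\<Sum>i<m. (\<Sum>j<m. X $$ (i * n + a, j * n + a) * v $ j) * cnj (v $ i))"
    proof (intro sum.cong refl)
      fix i assume "i \<in> {..<m}"
      hence i: "i < m" by simp
      have "(X *\<^sub>v u a) $ (i * n + a) = (\<Sum>j<m. \<Sum>b<n. X $$ (i * n + a, j * n + b) * u a $ (j * n + b))"
        unfolding index_mult_mat_vec_sum[OF x(1) u mult_add_less[OF i a]] sum_product_index ..
      also have "\<dots> = (\<Sum>j<m. \<Sum>b<n. if b = a then X $$ (i * n + a, j * n + a) * v $ j else 0)"
        by (intro sum.cong refl) (simp add: ui)
      also have "\<dots> = (\<Sum>j<m. X $$ (i * n + a, j * n + a) * v $ j)" using a by simp
      finally show "(X *\<^sub>v u a) $ (i * n + a) * cnj (v $ i) =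
        (\<Sum>j<m. X $$ (i * n + a, j * n + a) * v $ j) * cnj (v $ i)" by simp
    qed
    finally show ?thesis by (simp add: sum_distrib_right)
  qed
  hence "(\<Sum>a<n. (X *\<^sub>v u a) \<bullet>c u a) = (\<Sum>a<n. \<Sum>i<m. \<Sum>j<m. X $$ (i * n + a, j * n + a) * v $ j * cnj (v $ i))"
    by simp
  also have "\<dots> = (\<Sum>i<m. \<Sum>j<m. \<Sum>a<n. X $$ (i * n + a, j * n + a) * v $ j * cnj (v $ i))"
    by (subst sum.swap) (rule sum.cong[OF refl sum.swap])
  also have "\<dots> = (ptrace_snd m n X *\<^sub>v v) \<bullet>c v"
    unfolding cscalar_prod_sum[OF v]
    by (intro sum.cong refl, subst index_mult_mat_vec_sum[OF ptrace_carrier(2) v])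
      (auto simp: ptrace_snd_def sum_distrib_right)
  finally have "Re ((ptrace_snd m n X *\<^sub>v v) \<bullet>c v) = (\<Sum>a<n. Re ((X *\<^sub>v u a) \<bullet>c u a))"
    by (metis Re_sum)
  thus "0 \<le> Re ((ptrace_snd m n X *\<^sub>v v) \<bullet>c v)" using x(3)[OF u] by (simp add: sum_nonneg)
qed

text \<open>If \<open>S\<close> kills \<open>w\<close>, then \<open>P \<otimes>\<^sub>m S\<close>
  kills each \<open>u i\<close>, the \<open>i\<close>-th basis vector tensored with
  \<open>w\<close>, and therefore so does \<open>X\<close>. The partial trace applied to
  \<open>w\<close> only collects components of these images.\<close>

lemma kernel_le_ptrace_fst:
  assumes P: "P \<in> carrier_mat m m" and S: "S \<in> carrier_mat n n" and X: "X \<in> carrier_mat (m * n) (m * n)"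
    and k: "kernel_le (m * n) (P \<otimes>\<^sub>m S) X"
  shows "kernel_le n S (ptrace_fst m n X)"
  unfolding kernel_le_def
proof (intro ballI impI)
  fix w :: "complex vec" assume w: "w \<in> carrier_vec n" and Sw: "S *\<^sub>v w = 0\<^sub>v n"
  define u where "u i = vec (m * n) (\<lambda>p. if p div n = i then w $ (p mod n) else 0)" for i
  have u: "u i \<in> carrier_vec (m * n)" for i by (simp add: u_def)
  have Mu: "(M *\<^sub>v u i) $ p = (\<Sum>b<n. M $$ (p, i * n + b) * w $ b)"
    if M: "M \<in> carrier_mat (m * n) (m * n)" and p: "p < m * n" and i: "i < m" for M p i
  proof -
    have "(M *\<^sub>v u i) $ p = (\<Sum>j<m. \<Sum>b<n. M $$ (p, j * n + b) * u i $ (j * n + b))"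
      unfolding index_mult_mat_vec_sum[OF M u p] sum_product_index ..
    also have "\<dots> = (\<Sum>j<m. if j = i then \<Sum>b<n. M $$ (p, i * n + b) * w $ b else 0)"
      by (intro sum.cong refl) (auto simp: u_def mult_add_less intro!: sum.cong)
    also have "\<dots> = (\<Sum>b<n. M $$ (p, i * n + b) * w $ b)" using i by simp
    finally show ?thesis .
  qed
  have Xu: "X *\<^sub>v u i = 0\<^sub>v (m * n)" if i: "i < m" for i
  proof -
    have "(P \<otimes>\<^sub>m S) *\<^sub>v u i = 0\<^sub>v (m * n)"
    proof (rule eq_vecI)
      fix p assume "p < dim_vec (0\<^sub>v (m * n) :: complex vec)"
      hence p: "p < m * n" by simp
      note p' = div_mod_less[OF p]
      have "((P \<otimes>\<^sub>m S) *\<^sub>v u i) $ p = (\<Sum>b<n. (P \<otimes>\<^sub>m S) $$ (p, i * n + b) * w $ b)"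
        by (rule Mu[OF _ p i]) (use P S in auto)
      also have "\<dots> = (\<Sum>b<n. P $$ (p div n, i) * (S $$ (p mod n, b) * w $ b))"
        using P S p i by (intro sum.cong refl) (simp add: tensor_index mult_add_less)
      also have "\<dots> = P $$ (p div n, i) * (S *\<^sub>v w) $ (p mod n)"
        unfolding index_mult_mat_vec_sum[OF S w p'(2)] by (simp add: sum_distrib_left)
      finally show "((P \<otimes>\<^sub>m S) *\<^sub>v u i) $ p = 0\<^sub>v (m * n) $ p" using Sw p p' by simp
    qed (use P S in auto)
    thus ?thesis using k u by (simp add: kernel_le_def)
  qed
  show "ptrace_fst m n X *\<^sub>v w = 0\<^sub>v n"
  proof (rule eq_vecI)
    fix a assume "a < dim_vec (0\<^sub>v n :: complex vec)"
    hence a: "a < n" by simp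
    have "(ptrace_fst m n X *\<^sub>v w) $ a = (\<Sum>b<n. \<Sum>i<m. X $$ (i * n + a, i * n + b) * w $ b)"
      unfolding index_mult_mat_vec_sum[OF ptrace_carrier(1) w a]
      using a by (simp add: ptrace_fst_def sum_distrib_right)
    also have "\<dots> = (\<Sum>i<m. (X *\<^sub>v u i) $ (i * n + a))"
      by (subst sum.swap) (use a in \<open>simp add: Mu[OF X] mult_add_less\<close>)
    also have "\<dots> = 0" using a by (simp add: Xu mult_add_less)
    finally show "(ptrace_fst m n X *\<^sub>v w) $ a = 0\<^sub>v n $ a" using a by simp
  qed (simp add: ptrace_fst_def)
qed

subsection \<open>Channels\<close>

lemma quantum_channelD:
  assumes "quantum_channel dA dB N"
  shows "X \<in> carrier_mat dA dA \<Longrightarrow> N X \<in> carrier_mat dB dB"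
    "X \<in> carrier_mat dA dA \<Longrightarrow> Y \<in> carrier_mat dA dA \<Longrightarrow> N (X + Y) = N X + N Y"
    "X \<in> carrier_mat dA dA \<Longrightarrow> N (c \<cdot>\<^sub>m X) = c \<cdot>\<^sub>m N X"
    "X \<in> carrier_mat dA dA \<Longrightarrow> mat_trace (N X) = mat_trace X"
    "psd_mat (k * dA) Z \<Longrightarrow> psd_mat (k * dB) (id_tensor k dA dB N Z)"
  using assms unfolding quantum_channel_def by blast+

text \<open>Homogeneity with scalar 0. The off-diagonal blocks of a direct sum are zero matrices and
  must remain so under the channel.\<close>

lemma quantum_channel_zero:
  assumes "quantum_channel dA dB N"
  shows "N (0\<^sub>m dA dA) = 0\<^sub>m dB dB"
proof -
  have "N (0 \<cdot>\<^sub>m 0\<^sub>m dA dA) = 0 \<cdot>\<^sub>m N (0\<^sub>m dA dA)" by (rule quantum_channelD(3)[OF assms]) simp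
  moreover have "0 \<cdot>\<^sub>m 0\<^sub>m dA dA = (0\<^sub>m dA dA :: complex mat)" by (intro eq_matI) auto
  moreover have "0 \<cdot>\<^sub>m N (0\<^sub>m dA dA) = 0\<^sub>m dB dB"
    using quantum_channelD(1)[OF assms, of "0\<^sub>m dA dA"] by (intro eq_matI) auto
  ultimately show ?thesis by simp
qed

lemma block_mat_carrier [simp]: "block_mat n X i j \<in> carrier_mat n n"
  by (simp add: block_mat_def)

lemma id_tensor_carrier [simp]: "id_tensor k dA dB N X \<in> carrier_mat (k * dB) (k * dB)"
  by (simp add: id_tensor_def)

lemma id_tensor_index:
  assumes "i < k" "j < k" "a < dB" "b < dB"
  shows "id_tensor k dA dB N X $$ (i * dB + a, j * dB + b) = N (block_mat dA X i j) $$ (a, b)"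
  using assms by (simp add: id_tensor_def mult_add_less)

lemma mat_product_index_eqI:
  assumes A: "A \<in> carrier_mat (k * n) (k * n)" and B: "B \<in> carrier_mat (k * n) (k * n)"
    and eq: "\<And>i j a b. i < k \<Longrightarrow> j < k \<Longrightarrow> a < n \<Longrightarrow> b < n \<Longrightarrow> A $$ (i * n + a, j * n + b) = B $$ (i * n + a, j * n + b)"
  shows "A = B"
proof (rule eq_matI)
  fix p q assume "p < dim_row B" "q < dim_col B"
  hence p: "p < k * n" and q: "q < k * n" using B by auto
  show "A $$ (p, q) = B $$ (p, q)"
    using eq[OF div_mod_less(1)[OF p] div_mod_less(1)[OF q] div_mod_less(2)[OF p] div_mod_less(2)[OF q]] by simp
qed (use A B in auto)

lemma id_tensor_one:
  assumes N: "quantum_channel dA dB N" and X: "X \<in> carrier_mat dA dA"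
  shows "id_tensor 1 dA dB N X = N X"
proof -
  have "block_mat dA X 0 0 = X" using X by (intro eq_matI) (auto simp: block_mat_def)
  thus ?thesis using quantum_channelD(1)[OF N X]
    by (intro mat_product_index_eqI[of _ 1 dB]) (use id_tensor_index[of _ 1 _ _ dB _ dA N X] id_tensor_carrier[of 1 dA dB N X] in auto)
qed

text \<open>Positivity of \<open>N\<close> itself is complete positivity with a one-dimensional
  reference system.\<close>

lemma quantum_channel_state:
  assumes N: "quantum_channel dA dB N" and X: "quantum_state dA X"
  shows "quantum_state dB (N X)"
  using quantum_channelD(4)[OF N, of X] quantum_channelD(5)[OF N, of 1 X] id_tensor_one[OF N, of X] X
    psd_matD(1)[of dA X]
  by (auto simp: quantum_state_def)

lemma id_tensor_smult:
  assumes N: "quantum_channel dA dB N" and X: "X \<in> carrier_mat (k * dA) (k * dA)"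
  shows "id_tensor k dA dB N (c \<cdot>\<^sub>m X) = c \<cdot>\<^sub>m id_tensor k dA dB N X"
proof (rule mat_product_index_eqI[of _ k dB])
  fix i j a b assume *: "i < k" "j < k" "a < dB" "b < dB"
  have "block_mat dA (c \<cdot>\<^sub>m X) i j = c \<cdot>\<^sub>m block_mat dA X i j"
    using X * by (intro eq_matI) (auto simp: block_mat_def mult_add_less)
  hence "N (block_mat dA (c \<cdot>\<^sub>m X) i j) = c \<cdot>\<^sub>m N (block_mat dA X i j)"
    using quantum_channelD(3)[OF N block_mat_carrier] by simp
  thus "id_tensor k dA dB N (c \<cdot>\<^sub>m X) $$ (i * dB + a, j * dB + b) =
    (c \<cdot>\<^sub>m id_tensor k dA dB N X) $$ (i * dB + a, j * dB + b)"
    using * quantum_channelD(1)[OF N block_mat_carrier[of dA X i j]]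
      carrier_matD[OF id_tensor_carrier[of k dA dB N X]]
    by (simp add: id_tensor_index mult_add_less)
qed auto

lemma id_tensor_direct_sum:
  assumes N: "quantum_channel dA dB N" and X: "X \<in> carrier_mat (r * dA) (r * dA)" and Y: "Y \<in> carrier_mat dA dA"
  shows "id_tensor (Suc r) dA dB N (X \<oplus>\<^sub>m Y) = id_tensor r dA dB N X \<oplus>\<^sub>m N Y"
proof (rule mat_product_index_eqI[of _ "Suc r" dB])
  note NY = quantum_channelD(1)[OF N Y]
  show "id_tensor r dA dB N X \<oplus>\<^sub>m N Y \<in> carrier_mat (Suc r * dB) (Suc r * dB)"
    using direct_sum_carrier[OF id_tensor_carrier[of r dA dB N X] NY] by (simp add: add.commute)
  fix i j a b assume *: "i < Suc r" "j < Suc r" "a < dB" "b < dB"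
  hence ij: "i \<le> r" "j \<le> r" by auto
  have "block_mat dA (X \<oplus>\<^sub>m Y) i j =
    (if i < r \<and> j < r then block_mat dA X i j else if i = r \<and> j = r then Y else 0\<^sub>m dA dA)"
    using Y ij by (intro eq_matI) (auto simp: block_mat_def direct_sum_block_index[OF X Y])
  hence "N (block_mat dA (X \<oplus>\<^sub>m Y) i j) $$ (a, b) =
    (if i < r \<and> j < r then N (block_mat dA X i j) $$ (a, b) else if i = r \<and> j = r then N Y $$ (a, b) else 0)"
    using quantum_channel_zero[OF N] * by simp
  thus "id_tensor (Suc r) dA dB N (X \<oplus>\<^sub>m Y) $$ (i * dB + a, j * dB + b) =
    (id_tensor r dA dB N X \<oplus>\<^sub>m N Y) $$ (i * dB + a, j * dB + b)"
    unfolding id_tensor_index[OF *] direct_sum_block_index[OF id_tensor_carrier NY ij *(3,4)]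
    using * by (simp add: id_tensor_index)
qed (rule id_tensor_carrier)

text \<open>Trace preservation, applied to each block separately.\<close>

lemma ptrace_snd_id_tensor:
  assumes N: "quantum_channel dA dB N"
  shows "ptrace_snd k dB (id_tensor k dA dB N X) = ptrace_snd k dA X"
proof (rule eq_matI)
  fix i j assume "i < dim_row (ptrace_snd k dA X)" "j < dim_col (ptrace_snd k dA X)"
  hence ij: "i < k" "j < k" by (auto simp: ptrace_snd_def)
  have "mat_trace (N (block_mat dA X i j)) = mat_trace (block_mat dA X i j)"
    by (rule quantum_channelD(4)[OF N]) simp
  thus "ptrace_snd k dB (id_tensor k dA dB N X) $$ (i, j) = ptrace_snd k dA X $$ (i, j)"
    using ij quantum_channelD(1)[OF N block_mat_carrier[of dA X i j]]
    by (simp add: ptrace_snd_def id_tensor_index mat_trace_sum[of _ dB dB] mat_trace_sum[of _ dA dA] block_mat_def)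
qed (auto simp: ptrace_snd_def)

lemma ptrace_fst_id_tensor:
  assumes N: "quantum_channel dA dB N"
  shows "ptrace_fst k dB (id_tensor k dA dB N X) = N (ptrace_fst k dA X)"
proof -
  have step: "ptrace_fst (Suc m) dA X = ptrace_fst m dA X + block_mat dA X m m" for m
    by (intro eq_matI) (auto simp: ptrace_fst_def block_mat_def)
  have zero: "ptrace_fst 0 dA X = 0\<^sub>m dA dA" by (intro eq_matI) (auto simp: ptrace_fst_def)
  \<comment> \<open>The partial trace is the sum of the diagonal blocks; as \<open>N\<close> is
    known to be additive for two summands, the number \<open>m\<close> of blocks is built up by
    induction.\<close>
  have "N (ptrace_fst m dA X) = mat dB dB (\<lambda>(a, b). \<Sum>i<m. N (block_mat dA X i i) $$ (a, b))" for m
  proof (induction m)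
    case 0
    show ?case unfolding zero quantum_channel_zero[OF N] by (intro eq_matI) auto
  next
    case (Suc m)
    show ?case
      unfolding step quantum_channelD(2)[OF N ptrace_carrier(1) block_mat_carrier] Suc
      using quantum_channelD(1)[OF N block_mat_carrier[of dA X m m]] by (intro eq_matI) auto
  qed
  from this[of k] show ?thesis
    by (intro eq_matI) (auto simp: ptrace_fst_def id_tensor_index)
qed

subsection \<open>Splitting a state\<close>

text \<open>Let \<open>S\<close> be the value of the diagonal form at \<open>v\<close>. Where
  \<open>s j > 0\<close>, the squared modulus of \<open>v $ j\<close> is at most
  \<open>S / s j\<close>, so each entry of \<open>R\<close> contributes at most a constant times
  \<open>S\<close>. Coordinates with \<open>s j = 0\<close> are not controlled by \<open>S\<close>,
  but \<open>R\<close> has no entries there.\<close>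

lemma mat_diag_dominates:
  fixes s :: "nat \<Rightarrow> real"
  assumes R: "R \<in> carrier_mat n n" "hermitian_mat R" and s: "\<And>j. j < n \<Longrightarrow> 0 \<le> s j"
    and zero: "\<And>j k. j < n \<Longrightarrow> k < n \<Longrightarrow> s j = 0 \<or> s k = 0 \<Longrightarrow> R $$ (j, k) = 0"
  obtains c where "0 \<le> c" "\<And>l. 0 \<le> l \<Longrightarrow> l * c \<le> 1 \<Longrightarrow>
    psd_mat n (mat_diag n (\<lambda>i. complex_of_real (s i)) - complex_of_real l \<cdot>\<^sub>m R)"
proof
  \<comment> \<open>Collects the entrywise constants from
    \<open>2 * x * y \<le> x\<^sup>2 + y\<^sup>2\<close>, with the factor 2 given away. A summand
    with a vanishing \<open>s j\<close> or \<open>s k\<close> is 0 because its entry of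
    \<open>R\<close> is.\<close>
  define c where "c = (\<Sum>j<n. \<Sum>k<n. cmod (R $$ (j, k)) * (1 / s j + 1 / s k))"
  show "0 \<le> c" unfolding c_def using s by (intro sum_nonneg mult_nonneg_nonneg add_nonneg_nonneg) auto
  fix l :: real assume l: "0 \<le> l" "l * c \<le> 1"
  let ?D = "mat_diag n (\<lambda>i. complex_of_real (s i))"
  let ?M = "?D - complex_of_real l \<cdot>\<^sub>m R"
  show "psd_mat n ?M" unfolding psd_mat_def
  proof (intro conjI ballI)
    show M: "?M \<in> carrier_mat n n" using R by (intro minus_carrier_mat) simp
    show "hermitian_mat ?M" unfolding hermitian_mat_iff[OF M]
    proof (intro allI impI)
      fix i j assume ij: "i < n" "j < n"
      have sym: "R $$ (i, j) = cnj (R $$ (j, i))" using R(2)[unfolded hermitian_mat_iff[OF R(1)]] ij by blast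
      show "?M $$ (i, j) = cnj (?M $$ (j, i))" using ij R(1) by (simp add: mat_diag_def flip: sym)
    qed
    fix v :: "complex vec" assume v: "v \<in> carrier_vec n"
    define S where "S = (\<Sum>j<n. s j * (cmod (v $ j))\<^sup>2)"
    have S0: "0 \<le> S" unfolding S_def using s by (intro sum_nonneg) auto
    have comp: "(cmod (v $ j))\<^sup>2 \<le> S * (1 / s j)" if "j < n" "s j > 0" for j
    proof -
      have "s j * (cmod (v $ j))\<^sup>2 \<le> S" unfolding S_def
        using that s by (intro member_le_sum) auto
      thus ?thesis using that(2) by (simp add: field_simps)
    qed
    have bound: "cmod (R $$ (j, k)) * (cmod (v $ k) * cmod (v $ j)) \<le> S * (cmod (R $$ (j, k)) * (1 / s j + 1 / s k))"
      if j: "j < n" and k: "k < n" for j k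
    proof (cases "s j = 0 \<or> s k = 0")
      case False
      hence pos: "s j > 0" "s k > 0" using s[OF j] s[OF k] by auto
      have "2 * (cmod (v $ k) * cmod (v $ j)) \<le> (cmod (v $ k))\<^sup>2 + (cmod (v $ j))\<^sup>2"
        using sum_squares_bound[of "cmod (v $ k)" "cmod (v $ j)"] by simp
      also have "\<dots> \<le> S * (1 / s j + 1 / s k)"
        using comp[OF j pos(1)] comp[OF k pos(2)] by (simp add: distrib_left)
      finally have "cmod (v $ k) * cmod (v $ j) \<le> S * (1 / s j + 1 / s k)"
        using mult_nonneg_nonneg[OF norm_ge_zero norm_ge_zero, of "v $ k" "v $ j"] by linarith
      hence "cmod (R $$ (j, k)) * (cmod (v $ k) * cmod (v $ j)) \<le> cmod (R $$ (j, k)) * (S * (1 / s j + 1 / s k))"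
        by (intro mult_left_mono) auto
      thus ?thesis by (simp add: mult_ac)
    qed (use zero[OF j k] in auto)
    have Ov: "(R *\<^sub>v v) \<bullet>c v = (\<Sum>j<n. \<Sum>k<n. R $$ (j, k) * v $ k * cnj (v $ j))"
      unfolding cscalar_prod_sum[OF v]
      by (intro sum.cong refl, subst index_mult_mat_vec_sum[OF R(1) v]) (auto simp: sum_distrib_right)
    have "cmod ((R *\<^sub>v v) \<bullet>c v) \<le> (\<Sum>j<n. \<Sum>k<n. cmod (R $$ (j, k)) * (cmod (v $ k) * cmod (v $ j)))"
      unfolding Ov by (intro sum_norm_le) (simp add: norm_mult mult.assoc)
    also have "\<dots> \<le> (\<Sum>j<n. \<Sum>k<n. S * (cmod (R $$ (j, k)) * (1 / s j + 1 / s k)))"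
      using bound by (intro sum_mono) auto
    also have "\<dots> = S * c" by (simp add: c_def sum_distrib_left)
    finally have "Re ((R *\<^sub>v v) \<bullet>c v) \<le> S * c" using complex_Re_le_cmod order_trans by blast
    hence "l * Re ((R *\<^sub>v v) \<bullet>c v) \<le> l * (S * c)" using l(1) by (rule mult_left_mono)
    also have "\<dots> \<le> S" using mult_left_mono[OF l(2) S0] by (simp add: mult_ac)
    finally have "l * Re ((R *\<^sub>v v) \<bullet>c v) \<le> S" .
    moreover have "(?M *\<^sub>v v) \<bullet>c v = (?D *\<^sub>v v) \<bullet>c v - of_real l * ((R *\<^sub>v v) \<bullet>c v)"
    proof -
      have "(?M *\<^sub>v v) $ i = (?D *\<^sub>v v) $ i - of_real l * (R *\<^sub>v v) $ i" if i: "i < n" for i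
        unfolding index_mult_mat_vec_sum[OF M v i] index_mult_mat_vec_sum[OF mat_diag_dim v i]
          index_mult_mat_vec_sum[OF R(1) v i] sum_distrib_left sum_subtractf[symmetric]
        using i R(1) by (intro sum.cong refl) (simp add: mat_diag_def algebra_simps)
      thus ?thesis
        by (simp add: cscalar_prod_sum[OF v] left_diff_distrib sum_subtractf sum_distrib_left mult.assoc
            del: index_mult_mat_vec)
    qed
    ultimately show "0 \<le> Re ((?M *\<^sub>v v) \<bullet>c v)"
      by (simp add: cscalar_prod_mat_diag[OF v] S_def)
  qed
qed

text \<open>The decomposition forces \<open>T\<close> to be \<open>(S - l R) / (1 - l)\<close>, so
  \<open>T - S\<close> is \<open>l / (1 - l)\<close> times \<open>S - R\<close>. The chi-square
  divergence from \<open>S\<close> is quadratic in this difference, hence of order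
  \<open>l\<^sup>2\<close>. \<open>K\<close> and \<open>l0\<close> are fixed before \<open>l\<close>
  because the later limit needs one constant for all small \<open>l\<close>.\<close>

lemma state_split:
  assumes S: "quantum_state n S" and R: "R \<in> carrier_mat n n" "hermitian_mat R" "mat_trace R = 1"
    and k: "kernel_le n S R"
  obtains K l0 where "0 < l0" "\<And>l. 0 < l \<Longrightarrow> l \<le> l0 \<Longrightarrow> l \<le> 1 / 2 \<and> (\<exists>T. quantum_state n T \<and>
    S = complex_of_real l \<cdot>\<^sub>m R + complex_of_real (1 - l) \<cdot>\<^sub>m T \<and> rel_entropy T S \<le> ereal (K * l\<^sup>2))"
proof -
  have S': "psd_mat n S" "mat_trace S = 1" using S by (auto simp: quantum_state_def)
  note Sc = psd_matD(1,2)[OF S'(1)]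
  obtain V s where V: "diagonalizes n V s S" and s: "\<And>j. j < n \<Longrightarrow> 0 \<le> s j"
    using psd_diagonalizes[OF S'(1)] by blast
  note v = unitary_matD[OF diagonalizesD(1)[OF V]]
  let ?D = "mat_diag n (\<lambda>i. complex_of_real (s i))"
  \<comment> \<open>\<open>R\<close> in an eigenbasis of \<open>S\<close>, where both the domination
    of \<open>R\<close> and the chi-square sum become statements about entries.\<close>
  define P where "P = mat_adjoint V * R * V"
  have P: "P \<in> carrier_mat n n" using v R by (simp add: P_def)
  have Ph: "hermitian_mat P" unfolding P_def by (rule hermitian_mat_conj[OF R(1,2) v(1)])
  have Psym: "P $$ (j, k) = cnj (P $$ (k, j))" if "j < n" "k < n" for j k
    using Ph[unfolded hermitian_mat_iff[OF P]] that by blast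
  have Pcol: "P $$ (j, k) = 0" if j: "j < n" and kn: "k < n" and sk: "s k = 0" for j k
  proof -
    have "(R * V) $$ (l, k) = 0" if "l < n" for l
      by (rule kernel_le_eigenbasis[OF V R(1) k that kn sk])
    moreover have "P = mat_adjoint V * (R * V)"
      using v(1,2) R(1) by (simp add: P_def assoc_mult_mat[of _ n n _ n _ n])
    ultimately show ?thesis using index_mult_mat_sum[OF v(2) square_mult_carrier[OF R(1) v(1)] j kn] by simp
  qed
  \<comment> \<open>Columns vanish by the kernel condition, rows then by Hermitian symmetry.\<close>
  have Pzero: "P $$ (j, k) = 0" if "j < n" "k < n" "s j = 0 \<or> s k = 0" for j k
    using Pcol[of j k] Pcol[of k j] Psym[OF that(1,2)] that by auto
  have P_trace: "mat_trace P = 1"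
  proof -
    have "mat_trace P = mat_trace ((R * V) * mat_adjoint V)"
      using v(1,2) R(1) mat_trace_comm[of "mat_adjoint V" n n "R * V"]
      by (simp add: P_def assoc_mult_mat[of _ n n _ n _ n])
    also have "(R * V) * mat_adjoint V = R"
      using v(1,2,4) R(1) by (simp add: assoc_mult_mat[of _ n n _ n _ n])
    finally show ?thesis using R(3) by simp
  qed
  have VDV: "mat_adjoint V * S * V = ?D"
    using v(1,2,3) by (simp add: diagonalizes_mult_left[OF V] assoc_mult_mat[of _ n n _ n _ n])
  obtain c where c: "0 \<le> c" and dom: "\<And>l. 0 \<le> l \<Longrightarrow> l * c \<le> 1 \<Longrightarrow> psd_mat n (?D - complex_of_real l \<cdot>\<^sub>m P)"
    using mat_diag_dominates[OF P Ph, of s] s Pzero by blast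
  \<comment> \<open>\<open>Q - 1\<close> is the chi-square divergence of \<open>R\<close> from
    \<open>S\<close>.\<close>
  define Q where "Q = (\<Sum>j<n. \<Sum>k<n. (cmod (P $$ (j, k)))\<^sup>2 / s j)"
  have Q0: "0 \<le> Q" unfolding Q_def using s by (intro sum_nonneg) auto
  \<comment> \<open>The bound \<open>1 / 2\<close> keeps \<open>1 / (1 - l)\<close> at most 2, whose
    square is the 4 in the constant \<open>4 * Q\<close>. The bound \<open>1 / (c + 1)\<close>
    ensures \<open>l * c \<le> 1\<close>, with \<open>+ 1\<close> covering
    \<open>c = 0\<close>.\<close>
  define l0 where "l0 = min (1 / 2) (1 / (c + 1))"
  have l0: "0 < l0" using c by (simp add: l0_def)
  show thesis
  proof (rule that[OF l0, of "4 * Q"])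
    fix l :: real assume l: "0 < l" "l \<le> l0"
    have l2: "l \<le> 1 / 2" using l by (simp add: l0_def)
    have "l * c \<le> 1 / (c + 1) * c" using l c by (intro mult_right_mono) (auto simp: l0_def)
    also have "\<dots> \<le> 1" using c by (simp add: field_simps)
    finally have lc: "l * c \<le> 1" .
    define M where "M = ?D - complex_of_real l \<cdot>\<^sub>m P"
    have M: "psd_mat n M" unfolding M_def using dom[OF _ lc] l by simp
    define L where "L = S - complex_of_real l \<cdot>\<^sub>m R"
    have L: "L \<in> carrier_mat n n" using R by (simp add: L_def minus_carrier_mat)
    have VLV: "mat_adjoint V * L * V = M"
      using v(1,2) Sc(1) R(1)
      by (simp add: L_def M_def P_def VDV[symmetric] minus_mult_distrib_mat[of _ n n _ _ n]
        mult_minus_distrib_mat[of _ n n _ n] mult_smult_distrib[of _ n n _ n] mult_smult_assoc_mat[of _ n n _ n])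
    have "(V * mat_adjoint V) * L * (V * mat_adjoint V) = V * M * mat_adjoint V"
      unfolding VLV[symmetric] using v(1,2) L by (simp add: assoc_mult_mat[of _ n n _ n _ n])
    hence "L = V * M * mat_adjoint V" using v(4) L by simp
    hence Lpsd: "psd_mat n L" using psd_mat_conj[OF M v(2)] by simp
    define T where "T = complex_of_real (1 / (1 - l)) \<cdot>\<^sub>m L"
    have Tpsd: "psd_mat n T" unfolding T_def using l2 by (intro psd_mat_smult[OF Lpsd]) simp
    note Tc = psd_matD(1)[OF Tpsd]
    have "mat_trace L = 1 - of_real l" unfolding L_def
      using Sc(1) R S'(2) by (simp add: mat_trace_minus[of _ n] mat_trace_smult[of _ n])
    hence Ttr: "mat_trace T = 1" unfolding T_def mat_trace_smult[OF L] using l2 by simp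
    have split: "S = complex_of_real l \<cdot>\<^sub>m R + complex_of_real (1 - l) \<cdot>\<^sub>m T"
    proof -
      have "complex_of_real (1 - l) * (complex_of_real (1 / (1 - l)) * z) = z" for z
        using l2 by (simp flip: of_real_mult mult.assoc)
      hence "complex_of_real (1 - l) \<cdot>\<^sub>m T = L" unfolding T_def by (intro eq_matI) auto
      thus ?thesis unfolding L_def using Sc(1) R(1) by (intro eq_matI) auto
    qed
    have kT: "kernel_le n S T"
      unfolding kernel_le_def
    proof (intro ballI impI)
      fix w assume w: "w \<in> carrier_vec n" and Sw: "S *\<^sub>v w = 0\<^sub>v n"
      have Rw: "R *\<^sub>v w = 0\<^sub>v n" using k w Sw by (simp add: kernel_le_def)
      show "T *\<^sub>v w = 0\<^sub>v n"
      proof (rule eq_vecI)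
        fix i assume "i < dim_vec (0\<^sub>v n :: complex vec)"
        hence i: "i < n" by simp
        have "(T *\<^sub>v w) $ i = complex_of_real (1 / (1 - l)) * ((S *\<^sub>v w) $ i - complex_of_real l * (R *\<^sub>v w) $ i)"
          unfolding index_mult_mat_vec_sum[OF Tc w i] index_mult_mat_vec_sum[OF Sc(1) w i]
            index_mult_mat_vec_sum[OF R(1) w i] sum_distrib_left sum_subtractf[symmetric]
          using i Sc(1) R(1) by (intro sum.cong refl) (simp add: T_def L_def algebra_simps)
        thus "(T *\<^sub>v w) $ i = 0\<^sub>v n $ i" using i by (simp add: Sw Rw)
      qed (use Tc in simp)
    qed
    have VTV: "mat_adjoint V * T * V = complex_of_real (1 / (1 - l)) \<cdot>\<^sub>m M"
      unfolding T_def VLV[symmetric] using v(1,2) L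
      by (simp add: mult_smult_distrib[of _ n n _ n] mult_smult_assoc_mat[of _ n n _ n])
    have smult_sq: "(cmod ((complex_of_real a \<cdot>\<^sub>m M) $$ (j, k)))\<^sup>2 = a\<^sup>2 * (cmod (M $$ (j, k)))\<^sup>2"
      if "j < n" "k < n" for a j k
      using that psd_matD(1)[OF M] by (simp add: norm_mult power_mult_distrib)
    \<comment> \<open>The square is expanded and divided by \<open>s j\<close>. The identity
      survives \<open>s j = 0\<close>: the left side is then a quotient by 0, hence 0, and the right
      side vanishes by \<open>Pzero\<close>.\<close>
    have Mjk: "(cmod (M $$ (j, k)))\<^sup>2 / s j =
      (if j = k then s j - 2 * l * Re (P $$ (j, j)) else 0) + l\<^sup>2 * ((cmod (P $$ (j, k)))\<^sup>2 / s j)"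
      if jk: "j < n" "k < n" for j k
    proof (cases "s j = 0")
      case True
      thus ?thesis using Pzero[OF jk] by auto
    next
      case False
      have M_eq: "M $$ (j, k) = (if j = k then of_real (s j) else 0) - of_real l * P $$ (j, k)"
        using jk P by (simp add: M_def mat_diag_def)
      have "(cmod (M $$ (j, k)))\<^sup>2 =
        (if j = k then s j * (s j - 2 * l * Re (P $$ (j, j))) else 0) + l\<^sup>2 * (cmod (P $$ (j, k)))\<^sup>2"
        unfolding cmod_power2 M_eq by (simp add: power2_eq_square algebra_simps)
      thus ?thesis using False by (cases "j = k") (simp_all add: add_divide_distrib)
    qed
    have "(\<Sum>j<n. s j) = 1" using S'(2) unfolding diagonalizes_trace[OF V] of_real_eq_1_iff .
    moreover have "(\<Sum>j<n. Re (P $$ (j, j))) = 1" using P_trace by (simp add: mat_trace_sum[OF P] flip: Re_sum)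
    ultimately have "(\<Sum>j<n. \<Sum>k<n. if j = k then s j - 2 * l * Re (P $$ (j, j)) else 0) = 1 - 2 * l"
      by (simp add: sum_subtractf flip: sum_distrib_left)
    moreover have "(\<Sum>j<n. \<Sum>k<n. (cmod (M $$ (j, k)))\<^sup>2 / s j) =
      (\<Sum>j<n. \<Sum>k<n. if j = k then s j - 2 * l * Re (P $$ (j, j)) else 0) + l\<^sup>2 * Q"
      unfolding Q_def sum_distrib_left sum.distrib[symmetric] by (intro sum.cong refl Mjk) auto
    ultimately have sumM: "(\<Sum>j<n. \<Sum>k<n. (cmod (M $$ (j, k)))\<^sup>2 / s j) = 1 - 2 * l + l\<^sup>2 * Q" by simp
    have "rel_entropy T S \<le> ereal ((\<Sum>j<n. \<Sum>k<n. (cmod ((mat_adjoint V * T * V) $$ (j, k)))\<^sup>2 / s j) - 1)"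
      by (rule rel_entropy_le_chi_square[OF Tpsd Ttr V s kT])
    also have "(\<Sum>j<n. \<Sum>k<n. (cmod ((mat_adjoint V * T * V) $$ (j, k)))\<^sup>2 / s j) =
      (1 / (1 - l))\<^sup>2 * (\<Sum>j<n. \<Sum>k<n. (cmod (M $$ (j, k)))\<^sup>2 / s j)"
      unfolding VTV sum_distrib_left
      by (intro sum.cong refl) (simp add: smult_sq del: of_real_divide)
    \<comment> \<open>Since \<open>1 - 2 * l\<close> equals
      \<open>(1 - l)\<^sup>2 - l\<^sup>2\<close>, the subtracted 1 cancels exactly and nothing of
      lower order than \<open>l\<^sup>2\<close> remains.\<close>
    also have "\<dots> - 1 = (1 / (1 - l))\<^sup>2 * (l\<^sup>2 * (Q - 1))"
    proof -
      have "(1 / (1 - l))\<^sup>2 * (1 - l)\<^sup>2 = 1" using l2 by (simp flip: power_mult_distrib)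
      moreover have "1 - 2 * l + l\<^sup>2 * Q = (1 - l)\<^sup>2 + l\<^sup>2 * (Q - 1)"
        by (simp add: power2_eq_square algebra_simps)
      ultimately show ?thesis unfolding sumM by (simp only: distrib_left)
    qed
    also have "\<dots> \<le> 4 * (l\<^sup>2 * Q)"
    proof (rule order_trans)
      show "(1 / (1 - l))\<^sup>2 * (l\<^sup>2 * (Q - 1)) \<le> (1 / (1 - l))\<^sup>2 * (l\<^sup>2 * Q)"
        by (intro mult_left_mono) auto
      have "1 / (1 - l) \<le> 2" using l2 by (simp add: field_simps)
      hence "(1 / (1 - l))\<^sup>2 \<le> 2\<^sup>2" using l2 by (intro power_mono) auto
      thus "(1 / (1 - l))\<^sup>2 * (l\<^sup>2 * Q) \<le> 4 * (l\<^sup>2 * Q)" using Q0 by (intro mult_right_mono) auto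
    qed
    finally have "rel_entropy T S \<le> ereal (4 * Q * l\<^sup>2)" by (simp add: mult_ac)
    thus "l \<le> 1 / 2 \<and> (\<exists>T. quantum_state n T \<and>
      S = complex_of_real l \<cdot>\<^sub>m R + complex_of_real (1 - l) \<cdot>\<^sub>m T \<and> rel_entropy T S \<le> ereal (4 * Q * l\<^sup>2))"
      using l2 Tpsd Ttr split by (auto simp: quantum_state_def)
  qed
qed

subsection \<open>Flagged mixtures\<close>

text \<open>The reference carries the weights \<open>l\<close> and \<open>1 - l\<close> of the
  mixture, so on each block both arguments have the same scalar in front; additivity over blocks and
  homogeneity then apply.\<close>

lemma rel_entropy_flagged:
  assumes X: "psd_mat (r * n) X" and T: "psd_mat n T" and P: "psd_mat r P" and S: "psd_mat n S"
    and l: "0 < l" "l < 1"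
  shows "rel_entropy (complex_of_real l \<cdot>\<^sub>m X \<oplus>\<^sub>m complex_of_real (1 - l) \<cdot>\<^sub>m T)
      ((complex_of_real l \<cdot>\<^sub>m P \<oplus>\<^sub>m mat 1 1 (\<lambda>_. complex_of_real (1 - l))) \<otimes>\<^sub>m S) =
    ereal l * rel_entropy X (P \<otimes>\<^sub>m S) + ereal (1 - l) * rel_entropy T S"
proof -
  note PS = psd_mat_tensor[OF P S]
  have *: "psd_mat (r * n) (complex_of_real l \<cdot>\<^sub>m X)" "psd_mat (r * n) (complex_of_real l \<cdot>\<^sub>m (P \<otimes>\<^sub>m S))"
    "psd_mat n (complex_of_real (1 - l) \<cdot>\<^sub>m T)" "psd_mat n (complex_of_real (1 - l) \<cdot>\<^sub>m S)"
    using l by (auto intro!: psd_mat_smult X T PS S simp del: of_real_diff)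
  have "(complex_of_real l \<cdot>\<^sub>m P \<oplus>\<^sub>m mat 1 1 (\<lambda>_. complex_of_real (1 - l))) \<otimes>\<^sub>m S =
    complex_of_real l \<cdot>\<^sub>m (P \<otimes>\<^sub>m S) \<oplus>\<^sub>m complex_of_real (1 - l) \<cdot>\<^sub>m S"
    using psd_matD(1)[OF P] psd_matD(1)[OF S] by (subst tensor_direct_sum_left[of _ r _ n]) (auto simp: tensor_smult_left)
  thus ?thesis
    using rel_entropy_direct_sum[OF psd_matD(1,2)[OF *(1)] psd_matD(1,2)[OF *(2)] psd_matD(1,2)[OF *(3)] psd_matD(1,2)[OF *(4)]]
      rel_entropy_smult[OF X PS l(1)] rel_entropy_smult[OF T S, of "1 - l"] l by simp
qed

text \<open>Mutual information compares a state with its own marginals. The hypothesis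
  \<open>split\<close> makes the marginal on the channel input equal to \<open>S\<close>, and the
  flag makes the other marginal block diagonal with weights \<open>l\<close> and
  \<open>1 - l\<close>; so both mutual informations become entropies relative to the fixed
  \<open>S\<close> or \<open>N S\<close>.\<close>

lemma flagged_mixture:
  assumes N: "quantum_channel dA dB N" and X: "quantum_state (r * dA) X"
    and S: "quantum_state dA S" and T: "quantum_state dA T" and l: "0 < l" "l < 1"
    and split: "S = complex_of_real l \<cdot>\<^sub>m ptrace_fst r dA X + complex_of_real (1 - l) \<cdot>\<^sub>m T"
  defines "Y \<equiv> complex_of_real l \<cdot>\<^sub>m X \<oplus>\<^sub>m complex_of_real (1 - l) \<cdot>\<^sub>m T"
  shows "quantum_state (Suc r * dA) Y" "ptrace_fst (Suc r) dA Y = S"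
    "mutual_info (Suc r) dA Y =
      ereal l * rel_entropy X (ptrace_snd r dA X \<otimes>\<^sub>m S) + ereal (1 - l) * rel_entropy T S"
    "mutual_info (Suc r) dB (id_tensor (Suc r) dA dB N Y) =
      ereal l * rel_entropy (id_tensor r dA dB N X) (ptrace_snd r dA X \<otimes>\<^sub>m N S) +
      ereal (1 - l) * rel_entropy (N T) (N S)"
proof -
  have psd: "psd_mat (r * dA) X" "psd_mat dA T" "psd_mat dA S" and tr: "mat_trace X = 1" "mat_trace T = 1"
    using X T S by (auto simp: quantum_state_def)
  note c = psd_matD(1)[OF psd(1)] psd_matD(1)[OF psd(2)]
  have lX: "complex_of_real l \<cdot>\<^sub>m X \<in> carrier_mat (r * dA) (r * dA)"
    and lT: "complex_of_real (1 - l) \<cdot>\<^sub>m T \<in> carrier_mat dA dA" using c by auto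
  have "psd_mat (r * dA + dA) Y" unfolding Y_def
    using l by (intro psd_mat_direct_sum psd_mat_smult psd) auto
  moreover have "mat_trace Y = 1" unfolding Y_def direct_sum_trace[OF lX lT]
    using tr by (simp add: mat_trace_smult[OF c(1)] mat_trace_smult[OF c(2)])
  ultimately show "quantum_state (Suc r * dA) Y" by (simp add: quantum_state_def add.commute)
  show fst: "ptrace_fst (Suc r) dA Y = S"
    unfolding Y_def ptrace_fst_direct_sum[OF lX lT] ptrace_smult(1)[OF c(1)] by (rule split[symmetric])
  have snd: "ptrace_snd (Suc r) dA Y =
    complex_of_real l \<cdot>\<^sub>m ptrace_snd r dA X \<oplus>\<^sub>m mat 1 1 (\<lambda>_. complex_of_real (1 - l))"
    unfolding Y_def ptrace_snd_direct_sum[OF lX lT] ptrace_smult(2)[OF c(1)] mat_trace_smult[OF c(2)] tr by simp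
  note P = psd_ptrace_snd[OF psd(1)]
  show "mutual_info (Suc r) dA Y =
      ereal l * rel_entropy X (ptrace_snd r dA X \<otimes>\<^sub>m S) + ereal (1 - l) * rel_entropy T S"
    unfolding mutual_info_def fst snd unfolding Y_def
    by (rule rel_entropy_flagged[OF psd(1,2) P psd(3) l])
  have NT: "psd_mat dB (N T)" "psd_mat dB (N S)"
    using quantum_channel_state[OF N] T S by (auto simp: quantum_state_def)
  have NY: "id_tensor (Suc r) dA dB N Y = complex_of_real l \<cdot>\<^sub>m id_tensor r dA dB N X \<oplus>\<^sub>m complex_of_real (1 - l) \<cdot>\<^sub>m N T"
    unfolding Y_def id_tensor_direct_sum[OF N lX lT] id_tensor_smult[OF N c(1)] quantum_channelD(3)[OF N c(2)] ..
  show "mutual_info (Suc r) dB (id_tensor (Suc r) dA dB N Y) =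
      ereal l * rel_entropy (id_tensor r dA dB N X) (ptrace_snd r dA X \<otimes>\<^sub>m N S) +
      ereal (1 - l) * rel_entropy (N T) (N S)"
    unfolding mutual_info_def ptrace_snd_id_tensor[OF N] ptrace_fst_id_tensor[OF N] fst snd unfolding NY
    by (rule rel_entropy_flagged[OF quantum_channelD(5)[OF N psd(1)] NT(1) P NT(2) l])
qed

text \<open>For \<open>x \<ge> 0\<close> a larger denominator weakens the bound, and
  \<open>x / d\<close> is recovered in the limit of small \<open>l\<close>. For \<open>x < 0\<close>
  a larger denominator raises the quotient, so a single \<open>l\<close> suffices.\<close>

lemma Sup_ge_of_linear_perturbation:
  fixes S :: "ereal set"
  assumes d: "0 < d" and l0: "0 < l0"
    and S: "\<And>l. 0 < l \<Longrightarrow> l \<le> l0 \<Longrightarrow> \<exists>e. 0 \<le> e \<and> e \<le> K * l \<and> (\<exists>y \<in> S. ereal (x / (d + e)) \<le> y)"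
  shows "ereal (x / d) \<le> Sup S"
proof (cases "0 \<le> x")
  case True
  have lim: "((\<lambda>l. ereal (x / (d + K * l))) \<longlongrightarrow> ereal (x / (d + K * 0))) (at_right 0)"
    using d by (intro tendsto_intros) auto
  have "\<forall>\<^sub>F l in at_right 0. ereal (x / (d + K * l)) \<le> Sup S"
    unfolding eventually_at_right_field
  proof (intro exI conjI allI impI)
    fix l assume "0 < l" "l < l0"
    then obtain e y where e: "0 \<le> e" "e \<le> K * l" and y: "y \<in> S" "ereal (x / (d + e)) \<le> y"
      using S[of l] by auto
    have "x / (d + K * l) \<le> x / (d + e)" using e d True by (intro divide_left_mono) auto
    also have "ereal \<dots> \<le> Sup S" using y by (meson Sup_upper order_trans)
    finally show "ereal (x / (d + K * l)) \<le> Sup S" by simp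
  qed (rule l0)
  from tendsto_upperbound[OF lim this] show ?thesis by simp
next
  case False
  obtain e y where e: "0 \<le> e" and y: "y \<in> S" "ereal (x / (d + e)) \<le> y" using S[OF l0] by auto
  have "x / d \<le> x / (d + e)" using False d e by (simp add: divide_simps mult_left_mono_neg)
  also have "ereal \<dots> \<le> Sup S" using y by (meson Sup_upper order_trans)
  finally show ?thesis by simp
qed

text \<open>Excludes \<open>-\<infinity>\<close>, since the branch with the trace is real.\<close>

lemma rel_entropy_cases:
  assumes "A \<in> carrier_mat n n" "B \<in> carrier_mat n n" "hermitian_mat A"
  obtains "rel_entropy A B = \<infinity>" | x where "rel_entropy A B = ereal x"
  using rel_entropy_eq[OF assms] by (cases "kernel_le n B A") auto

text \<open>After cancelling \<open>l\<close>, the ratio of the flagged mixture is the given one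
  with \<open>w \<ge> 0\<close> added to the numerator and \<open>e\<close>, at most linear in
  \<open>l\<close>, added to the denominator. Nonemptiness is recorded because
  \<open>sup_or_zero\<close> sends the empty set to 0.\<close>

lemma eta_D_prod_ratio_le:
  assumes N: "quantum_channel dA dB N" and S: "quantum_state dA \<sigma>"
    and X: "quantum_state (r * dA) X"
    and pos: "0 < rel_entropy X (ptrace_snd r dA X \<otimes>\<^sub>m \<sigma>)"
    and fin: "rel_entropy X (ptrace_snd r dA X \<otimes>\<^sub>m \<sigma>) < \<infinity>"
  defines "M \<equiv> {mutual_info c dB (id_tensor c dA dB N \<rho>) / mutual_info c dA \<rho> | c \<rho>.
        quantum_state (c * dA) \<rho> \<and> ptrace_fst c dA \<rho> = \<sigma> \<and>
        0 < mutual_info c dA \<rho> \<and> mutual_info c dA \<rho> < \<infinity>}"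
  shows "M \<noteq> {}" and
    "rel_entropy (id_tensor r dA dB N X) (ptrace_snd r dA X \<otimes>\<^sub>m N \<sigma>) /
      rel_entropy X (ptrace_snd r dA X \<otimes>\<^sub>m \<sigma>) \<le> Sup M"
proof -
  have psd: "psd_mat (r * dA) X" "psd_mat dA \<sigma>" and tr: "mat_trace X = 1"
    using X S by (auto simp: quantum_state_def)
  note Xc = psd_matD(1,2)[OF psd(1)] and P = psd_ptrace_snd[OF psd(1)]
  note PS = psd_mat_tensor[OF P psd(2)]
  obtain d where d: "rel_entropy X (ptrace_snd r dA X \<otimes>\<^sub>m \<sigma>) = ereal d"
    using pos fin by (cases "rel_entropy X (ptrace_snd r dA X \<otimes>\<^sub>m \<sigma>)") auto
  have d0: "0 < d" using pos d by simp
  have "kernel_le (r * dA) (ptrace_snd r dA X \<otimes>\<^sub>m \<sigma>) X"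
    using d rel_entropy_eq[OF Xc(1) psd_matD(1)[OF PS] Xc(2)] by (auto split: if_splits)
  hence k: "kernel_le dA \<sigma> (ptrace_fst r dA X)"
    using kernel_le_ptrace_fst[OF psd_matD(1)[OF P] psd_matD(1)[OF psd(2)] Xc(1)] by simp
  have "mat_trace (ptrace_fst r dA X) = 1" by (simp add: mat_trace_ptrace_fst[OF Xc(1)] tr)
  then obtain K l0 where l0: "0 < l0" and split: "\<And>l. 0 < l \<Longrightarrow> l \<le> l0 \<Longrightarrow> l \<le> 1 / 2 \<and> (\<exists>T. quantum_state dA T \<and>
    \<sigma> = complex_of_real l \<cdot>\<^sub>m ptrace_fst r dA X + complex_of_real (1 - l) \<cdot>\<^sub>m T \<and> rel_entropy T \<sigma> \<le> ereal (K * l\<^sup>2))"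
    using state_split[OF S ptrace_carrier(1) hermitian_ptrace_fst[OF Xc] _ k] by blast
  let ?num = "rel_entropy (id_tensor r dA dB N X) (ptrace_snd r dA X \<otimes>\<^sub>m N \<sigma>)"
  have witness: "\<exists>e w. 0 \<le> e \<and> e \<le> K * l \<and> 0 \<le> w \<and> (?num + w) / ereal (d + e) \<in> M" if l: "0 < l" "l \<le> l0" for l
  proof -
    obtain T where l2: "l \<le> 1 / 2" and T: "quantum_state dA T"
      and \<sigma>: "\<sigma> = complex_of_real l \<cdot>\<^sub>m ptrace_fst r dA X + complex_of_real (1 - l) \<cdot>\<^sub>m T"
      and le: "rel_entropy T \<sigma> \<le> ereal (K * l\<^sup>2)"
      using split[OF l] by blast
    have l1: "l < 1" using l2 by simp
    note mix = flagged_mixture[OF N X S T l(1) l1 \<sigma>]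
    have "0 \<le> rel_entropy T \<sigma>"
      using T S by (intro rel_entropy_nonneg[of dA]) (auto simp: quantum_state_def)
    then obtain t where t: "rel_entropy T \<sigma> = ereal t" "0 \<le> t" "t \<le> K * l\<^sup>2"
      using le by (cases "rel_entropy T \<sigma>") auto
    have "quantum_state dB (N T)" "quantum_state dB (N \<sigma>)"
      using quantum_channel_state[OF N] T S by auto
    hence n0: "0 \<le> rel_entropy (N T) (N \<sigma>)"
      by (intro rel_entropy_nonneg[of dB]) (auto simp: quantum_state_def)
    \<comment> \<open>The \<tau> term of the denominator divided by \<open>l\<close>: the quadratic
      bound on \<open>t\<close> becomes a linear one on \<open>e\<close>.\<close>
    define e where "e = (1 - l) * t / l"
    define w where "w = ereal ((1 - l) / l) * rel_entropy (N T) (N \<sigma>)"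
    have "(1 - l) * t \<le> 1 * t" using l t by (intro mult_right_mono) auto
    hence "e \<le> K * l\<^sup>2 / l" unfolding e_def using t l by (intro divide_right_mono) auto
    hence e: "0 \<le> e" "e \<le> K * l" using t l l1 by (auto simp: e_def power2_eq_square)
    have w: "0 \<le> w" unfolding w_def using l l1 n0 by (intro ereal_0_le_mult) auto
    define Y where "Y = complex_of_real l \<cdot>\<^sub>m X \<oplus>\<^sub>m complex_of_real (1 - l) \<cdot>\<^sub>m T"
    have den: "mutual_info (Suc r) dA Y = ereal (l * (d + e))"
      unfolding Y_def mix(3) d t using l by (simp add: e_def field_simps)
    have lw: "ereal l * w = ereal (1 - l) * rel_entropy (N T) (N \<sigma>)"
      unfolding w_def using l by (simp flip: mult.assoc)
    have num: "mutual_info (Suc r) dB (id_tensor (Suc r) dA dB N Y) = ereal l * (?num + w)"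
      unfolding Y_def mix(4) lw[symmetric] using l by (simp add: ereal_pos_distrib)
    \<comment> \<open>Stated for every extended real \<open>z\<close>, because the output entropy in
      the numerator may be infinite.\<close>
    have ratio: "ereal l * z / ereal (l * (d + e)) = z / ereal (d + e)" for z
      using l d0 e by (cases z) (auto simp: zero_less_mult_iff)
    have "0 < l * (d + e)" using l d0 e by simp
    hence "ereal l * (?num + w) / ereal (l * (d + e)) \<in> M"
      unfolding M_def num[symmetric] den[symmetric] using mix(1,2) den
      by (intro CollectI exI[of _ "Suc r"] exI[of _ Y]) (auto simp: Y_def)
    thus ?thesis using e w unfolding ratio by blast
  qed
  show "M \<noteq> {}" using witness[OF l0] by auto
  have NX: "psd_mat (r * dB) (id_tensor r dA dB N X)" "psd_mat (r * dB) (ptrace_snd r dA X \<otimes>\<^sub>m N \<sigma>)"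
    using quantum_channelD(5)[OF N psd(1)] psd_mat_tensor[OF P] quantum_channel_state[OF N S]
    by (auto simp: quantum_state_def)
  show "?num / rel_entropy X (ptrace_snd r dA X \<otimes>\<^sub>m \<sigma>) \<le> Sup M"
    unfolding d
  proof (cases rule: rel_entropy_cases[OF psd_matD(1)[OF NX(1)] psd_matD(1)[OF NX(2)] psd_matD(2)[OF NX(1)]])
    \<comment> \<open>With an infinite numerator a single mixture already has an infinite ratio, so
      no limit is taken.\<close>
    case 1
    obtain e w where "0 \<le> e" "0 \<le> w" "(?num + w) / ereal (d + e) \<in> M" using witness[OF l0 order_refl] by auto
    hence "\<infinity> \<in> M" using d0 1 by (auto simp: divide_ereal_def)
    hence "Sup M = \<infinity>" by (simp add: Sup_eq_PInfty)
    thus "?num / ereal d \<le> Sup M" by simp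
  next
    case (2 x)
    have "ereal (x / d) \<le> Sup M"
    proof (rule Sup_ge_of_linear_perturbation[OF d0 l0, of K])
      fix l assume "0 < l" "l \<le> l0"
      from witness[OF this] obtain e w where e: "0 \<le> e" "e \<le> K * l" "0 \<le> w"
        and m: "(?num + w) / ereal (d + e) \<in> M" by blast
      have "ereal (x / (d + e)) = ereal x / ereal (d + e)" using d0 e by simp
      \<comment> \<open>Discarding the nonnegative \<open>w\<close> can only lower the
        quotient.\<close>
      also have "\<dots> \<le> (?num + w) / ereal (d + e)"
        unfolding 2 using e d0 by (intro ereal_divide_right_mono) (auto simp: add_increasing2)
      finally show "\<exists>e. 0 \<le> e \<and> e \<le> K * l \<and> (\<exists>y \<in> M. ereal (x / (d + e)) \<le> y)" using e m by blast
    qed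
    thus "?num / ereal d \<le> Sup M" using 2 d0 by simp
  qed
qed

theorem mainTheorem7:
  fixes dA dB :: nat and N :: "complex mat \<Rightarrow> complex mat" and \<sigma> :: "complex mat"
  assumes "quantum_channel dA dB N"
    and "quantum_state dA \<sigma>"
  shows "eta_MI dA dB N \<sigma> = eta_D_prod dA dB N \<sigma>"
proof -
  let ?M = "{mutual_info c dB (id_tensor c dA dB N \<rho>) / mutual_info c dA \<rho> | c \<rho>.
        quantum_state (c * dA) \<rho> \<and> ptrace_fst c dA \<rho> = \<sigma> \<and>
        0 < mutual_info c dA \<rho> \<and> mutual_info c dA \<rho> < \<infinity>}"
  let ?D = "{rel_entropy (id_tensor r dA dB N \<rho>) (ptrace_snd r dA \<rho> \<otimes>\<^sub>m N \<sigma>) /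
      rel_entropy \<rho> (ptrace_snd r dA \<rho> \<otimes>\<^sub>m \<sigma>) | r \<rho>.
        quantum_state (r * dA) \<rho> \<and>
        0 < rel_entropy \<rho> (ptrace_snd r dA \<rho> \<otimes>\<^sub>m \<sigma>) \<and>
        rel_entropy \<rho> (ptrace_snd r dA \<rho> \<otimes>\<^sub>m \<sigma>) < \<infinity>}"
  \<comment> \<open>When the input marginal is \<open>\<sigma>\<close>, the output has the marginals
    of the untouched reference and \<open>N \<sigma>\<close>, so the mutual-information ratio is
    literally a product-reference ratio.\<close>
  have sub: "?M \<subseteq> ?D"
  proof
    fix y assume "y \<in> ?M"
    then obtain c \<rho> where "quantum_state (c * dA) \<rho>" and \<rho>: "ptrace_fst c dA \<rho> = \<sigma>"
      and "0 < mutual_info c dA \<rho>" "mutual_info c dA \<rho> < \<infinity>"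
      and "y = mutual_info c dB (id_tensor c dA dB N \<rho>) / mutual_info c dA \<rho>" by blast
    thus "y \<in> ?D"
      unfolding mutual_info_def ptrace_snd_id_tensor[OF assms(1)] ptrace_fst_id_tensor[OF assms(1)] \<rho>
      by blast
  qed
  have "eta_MI dA dB N \<sigma> = sup_or_zero ?M" "eta_D_prod dA dB N \<sigma> = sup_or_zero ?D"
    unfolding eta_MI_def eta_D_prod_def by rule+
  \<comment> \<open>The empty set gets the value 0 and not its supremum, so the two sets must be
    empty together: \<open>sub\<close> gives one direction, the nonemptiness part of
    \<open>ratio\<close> the other.\<close>
  moreover have "sup_or_zero ?M = sup_or_zero ?D"
  proof (cases "?D = {}")
    case True
    hence "?M = ?D" using sub by blast
    thus ?thesis by (rule arg_cong)
  next
    case False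
    have ratio: "?M \<noteq> {} \<and> y \<le> Sup ?M" if yD: "y \<in> ?D" for y
    proof -
      obtain r \<rho> where "quantum_state (r * dA) \<rho>" "0 < rel_entropy \<rho> (ptrace_snd r dA \<rho> \<otimes>\<^sub>m \<sigma>)"
        "rel_entropy \<rho> (ptrace_snd r dA \<rho> \<otimes>\<^sub>m \<sigma>) < \<infinity>"
        and y: "y = rel_entropy (id_tensor r dA dB N \<rho>) (ptrace_snd r dA \<rho> \<otimes>\<^sub>m N \<sigma>) /
          rel_entropy \<rho> (ptrace_snd r dA \<rho> \<otimes>\<^sub>m \<sigma>)"
        using yD by blast
      from eta_D_prod_ratio_le[OF assms this(1-3)] show ?thesis unfolding y ..
    qed
    have "Sup ?D \<le> Sup ?M" by (rule Sup_least) (use ratio in blast)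
    moreover have "Sup ?M \<le> Sup ?D" by (rule Sup_subset_mono[OF sub])
    moreover have "?M \<noteq> {}" using ratio False by blast
    ultimately show ?thesis using False unfolding sup_or_zero_def by (simp only: if_False antisym)
  qed
  ultimately show ?thesis by simp
qed

end
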